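(* Let $f\in L_{2\pi}$ be a complex valued function. Suppose that the Fourier coefficients of $f$ satisfy $$\lim_{\lambda\to 1+0}\ \limsup_{n\to\infty}\sum_{k=n}^{[\lambda n]}\left|\Delta\hat{f}(k)-\Delta\hat{f}(-k)\right|\log k = 0,$$ and that $\{\hat{f}(n)\}_{n=0}^{+\infty}\in \mathrm{GBV}$. Then $$\lim_{n\to\infty}\|f-S_{n}(f)\|=0\quad\text{if and only if}\quad \lim_{|n|\to\infty}\hat{f}(n)\log|n|=0.$$
   Context: $L_{2\pi}$ is the space of all real or complex valued integrable functions $f$ of period $2\pi$ with norm $\|f\|=\int_{-\pi}^{\pi}|f(x)|\,dx$. The Fourier series of $f$ is $\sum_{k=-\infty}^{\infty}\hat f(k)e^{ikx}$, with $\hat f(k)=\frac1{2\pi}\int_{-\pi}^{\pi}f(x)e^{-ikx}dx$, and $S_n(f)=S_n(f,x)=\sum_{k=-n}^{n}\hat f(k)e^{ikx}$. $[x]$ is the integer part of $x$. For a sequence $\{c_n\}$, $\Delta c_n=c_n-c_{n+1}$; in particular, for $k\ge 0$, $\Delta\hat f(k)=\hat f(k)-\hat f(k+1)$ and $\Delta\hat f(-k)=\hat f(-k)-\hat f(-k-1)$ (the difference of the sequence $\{\hat f(-k)\}_{k\ge0}$). For $\theta\in[0,\pi/2)$ put $K(\theta)=\{z\in\mathbb{C}:|\arg z|\le\theta\}$ (with $0\in K(\theta)$). Class GBV: a complex sequence $\mathbf c=\{c_n\}_{n=1}^\infty$ belongs to GBV if there is $\theta_1\in[0,\pi/2)$ with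 $c_n\in K(\theta_1)$ for all $n=1,2,\dots$, and there are a natural number $N_0\ge1$ and a positive constant $M(\mathbf c)$ depending only on $\mathbf c$ such that $$\sum_{n=m}^{2m}|\Delta c_n|\le M(\mathbf c)\max_{m\le n<m+N_0}|c_n|\quad\text{for all } m=1,2,\dots.$$ For a sequence indexed from $n=0$, membership in GBV means that these conditions hold for its terms with index $n\ge1$. *)

theory Defs
  imports "HOL-Analysis.Analysis"
begin

(* Lebesgue (completed) measure, so that functions which are Lebesgue but not Borel
   measurable are included. *)
definition L_2pi :: "(real \<Rightarrow> complex) set" where
  "L_2pi = {f. (\<forall>x. f (x + 2 * pi) = f x) \<and> set_integrable lebesgue {-pi..pi} f}"

definition L_norm :: "(real \<Rightarrow> complex) \<Rightarrow> real" where
  "L_norm f = (LINT x:{-pi..pi}|lebesgue. norm (f x))"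

definition fourier_coeff :: "(real \<Rightarrow> complex) \<Rightarrow> int \<Rightarrow> complex" where
  "fourier_coeff f k =
     1 / (2 * of_real pi) *
       (LINT x:{-pi..pi}|lebesgue. f x * exp (- \<i> * of_int k * of_real x))"

definition fourier_sum :: "nat \<Rightarrow> (real \<Rightarrow> complex) \<Rightarrow> real \<Rightarrow> complex" where
  "fourier_sum n f x =
     (\<Sum>k\<in>{- int n..int n}. fourier_coeff f k * exp (\<i> * of_int k * of_real x))"

definition seq_diff :: "(nat \<Rightarrow> complex) \<Rightarrow> nat \<Rightarrow> complex" where
  "seq_diff c n = c n - c (Suc n)"

(* Arg is the principal argument in (-pi, pi], and Arg 0 = 0, so that 0 belongs to
   the sector whenever \<theta> \<ge> 0. *)
definition sector :: "real \<Rightarrow> complex set" where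
  "sector \<theta> = {z. \<bar>Arg z\<bar> \<le> \<theta>}"

(* Sequences are indexed by nat; the term with index 0 is unconstrained. *)
definition GBV :: "(nat \<Rightarrow> complex) set" where
  "GBV = {c.
     (\<exists>\<theta>\<in>{0..<pi/2}. \<forall>n\<ge>1. c n \<in> sector \<theta>) \<and>
     (\<exists>N\<^sub>0\<ge>1. \<exists>M>0. \<forall>m\<ge>1.
        (\<Sum>n=m..2*m. norm (seq_diff c n)) \<le> M * Max ((\<lambda>n. norm (c n)) ` {m..<m + N\<^sub>0}))}"

end

theory Submission
  imports Defs
begin

text \<open>
  Write \<open>a\<close> and \<open>b\<close> for the Fourier coefficients at nonnegative and nonpositive frequencies.

  Sufficiency of the logarithmic decay. The averages of the partial sums over blocks of indices
  from \<open>n\<close> to \<open>lam * n\<close> converge to \<open>f\<close> in the mean, since they are bounded combinations of Fejer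
  means (lemma \<open>fejer_L1\<close>). It therefore suffices that the partial sums oscillate little over such
  a block (lemma \<open>fourier_sum_converges_if_slowly_oscillating\<close>). Summation by parts bounds the
  norm of a block by \<open>ln n\<close> times the size and variation of its coefficients (lemma
  \<open>L_norm_block_le\<close>). The variation of \<open>a\<close> is at most a constant times its size by the GBV condition,
  and the variation of \<open>b\<close> exceeds that of \<open>a\<close> only by the sum in the limit hypothesis; so everything
  is small compared with \<open>1 / ln n\<close>.

  Necessity. If the partial sums converge, then differences of partial sums tend to 0 in norm.
  Testing such a difference against a modulated sawtooth, a bounded function with Fourier
  coefficients proportional to \<open>1 / k\<close>, shows that the sums of \<open>a k / (m - k)\<close> over the roughly
  \<open>sqrt m\<close> indices preceding \<open>m\<close> tend to 0, and likewise for \<open>b\<close> (lemma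
  \<open>hilbert_window_tendsto_0\<close>). As \<open>a\<close> has its values in a sector, no cancellation can occur in its
  sums, and the GBV condition compares \<open>a m\<close> with the values in the window; since the
  weights add up to at least \<open>ln m / 2\<close>, this gives the decay of \<open>a\<close> (lemma
  \<open>GBV_coeff_log_tendsto_0\<close>). For \<open>a - b\<close> the limit hypothesis says that the sequence is almost
  constant on the window, up to \<open>o(1 / ln m)\<close>, so its weighted sums are again comparable with
  \<open>ln m\<close> times its value at \<open>m\<close> (lemma \<open>slow_variation_coeff_log_tendsto_0\<close>). Subtracting gives the
  decay of \<open>b\<close>.
\<close>

section \<open>Fourier coefficients and the norm on one period\<close>

definition trig :: "int \<Rightarrow> real \<Rightarrow> complex" where
  "trig k x = exp (\<i> * of_int k * of_real x)"

abbreviation period_measure :: "real measure" where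
  "period_measure \<equiv> lebesgue_on {-pi..pi}"

lemma norm_trig [simp]: "norm (trig k x) = 1"
  by (simp add: trig_def)

lemma trig_0 [simp]: "trig 0 x = 1"
  by (simp add: trig_def)

lemma trig_add: "trig (j + k) x = trig j x * trig k x"
  by (simp add: trig_def exp_add [symmetric] algebra_simps)

lemma cnj_trig: "cnj (trig k x) = trig (- k) x"
  by (simp add: trig_def exp_cnj)

lemma trig_of_nat: "trig (int n) x = trig 1 x ^ n"
  by (simp add: trig_def exp_of_nat_mult [symmetric] algebra_simps)

lemma trig_minus_pi: "trig k (- pi) = trig k pi"
proof -
  have "\<i> * of_int k * of_real pi = \<i> * of_int k * of_real (-pi) + of_int k * (of_real (2 * pi) * \<i>)"
    by (simp add: algebra_simps)
  hence "trig k pi = trig k (-pi) * exp (of_int k * (of_real (2 * pi) * \<i>))"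
    unfolding trig_def by (simp only: exp_add)
  also have "exp (of_int k * (of_real (2 * pi) * \<i>)) = 1"
    using exp_integer_2pi[of "of_int k"] by (simp add: mult_ac)
  finally show ?thesis by simp
qed

lemma continuous_on_trig [continuous_intros]: "continuous_on S (trig k)"
  unfolding trig_def by (intro continuous_intros)

lemma fourier_coeff_eq:
  "fourier_coeff f k = (LINT x|period_measure. f x * trig (- k) x) / (2 * of_real pi)"
  unfolding fourier_coeff_def set_lebesgue_integral_def
  by (simp add: integral_restrict_space trig_def)

lemma fourier_sum_eq: "fourier_sum n f x = (\<Sum>k\<in>{- int n..int n}. fourier_coeff f k * trig k x)"
  by (simp add: fourier_sum_def trig_def)

lemma L_norm_eq: "L_norm f = (LINT x|period_measure. norm (f x))"
  unfolding L_norm_def set_lebesgue_integral_def by (simp add: integral_restrict_space)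

lemma set_integrable_period_iff:
  fixes f :: "real \<Rightarrow> 'a::{banach, second_countable_topology}"
  shows "set_integrable lebesgue {-pi..pi} f \<longleftrightarrow> integrable period_measure f"
  unfolding set_integrable_def by (simp add: integrable_restrict_space)

lemma finite_measure_period: "finite_measure period_measure"
  by (rule finite_measure_lebesgue_on) auto

lemma integrable_continuous_period:
  fixes g :: "real \<Rightarrow> 'a::euclidean_space"
  assumes "continuous_on {-pi..pi} g"
  shows "integrable period_measure g"
  using continuous_imp_integrable_real[OF assms] .

lemma integrable_trig [intro, simp]: "integrable period_measure (trig k)"
  by (rule integrable_continuous_period) (intro continuous_intros)

lemma integrable_mult_bounded_period:
  fixes f :: "real \<Rightarrow> complex"
  assumes "integrable period_measure f" "h \<in> borel_measurable period_measure" "\<And>x. x \<in> {-pi..pi} \<Longrightarrow> norm (h x) \<le> B"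
  shows "integrable period_measure (\<lambda>x. f x * h x)"
proof (rule Bochner_Integration.integrable_bound)
  show "integrable period_measure (\<lambda>x. B * norm (f x))" using assms by simp
  show "(\<lambda>x. f x * h x) \<in> borel_measurable period_measure"
    using assms by (intro borel_measurable_times) auto
  have "norm (f x * h x) \<le> norm (B * norm (f x))" if "x \<in> {-pi..pi}" for x
  proof -
    have "norm (f x) * norm (h x) \<le> norm (f x) * B"
      using assms(3) that by (intro mult_left_mono) auto
    moreover have "B \<ge> 0" using assms(3)[OF that] norm_ge_zero order_trans by blast
    ultimately show ?thesis by (simp add: norm_mult mult.commute)
  qed
  thus "AE x in period_measure. norm (f x * h x) \<le> norm (B * norm (f x))" by (intro AE_I2) simp
qed

lemma integrable_mult_trig [intro]:
  assumes "integrable period_measure f"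
  shows "integrable period_measure (\<lambda>x. f x * trig k x)"
  by (rule integrable_mult_bounded_period[OF assms borel_measurable_integrable[OF integrable_trig], of _ 1]) simp

lemma integrable_fourier_sum [intro, simp]: "integrable period_measure (fourier_sum n f)"
  unfolding fourier_sum_eq[abs_def] by (auto intro!: Bochner_Integration.integrable_sum)

lemma integral_trig: "(LINT x|period_measure. trig k x) = (if k = 0 then 2 * of_real pi else 0)"
proof (cases "k = 0")
  case True
  have "trig 0 = (\<lambda>x. 1)" by (auto simp: fun_eq_iff)
  thus ?thesis using True by (simp add: measure_restrict_space scaleR_conv_of_real)
next
  case False
  define F where "F = (\<lambda>x. trig k x / (\<i> * of_int k))"
  have "(F has_vector_derivative trig k x) (at x within {-pi..pi})" for x
    using False unfolding F_def trig_def
    by (auto intro!: derivative_eq_intros has_vector_derivative_real_field)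
  hence "(trig k has_integral (F pi - F (-pi))) {-pi..pi}"
    by (intro fundamental_theorem_of_calculus) auto
  moreover have "F pi = F (-pi)" by (simp add: F_def trig_minus_pi)
  ultimately show ?thesis using False
    by (simp add: lebesgue_integral_eq_integral integral_unique)
qed

lemma fourier_coeff_trig: "fourier_coeff (trig m) k = (if k = m then 1 else 0)"
  by (simp add: fourier_coeff_eq trig_add[symmetric] integral_trig)

lemma fourier_coeff_add:
  assumes "integrable period_measure f" "integrable period_measure g"
  shows "fourier_coeff (\<lambda>x. f x + g x) k = fourier_coeff f k + fourier_coeff g k"
  using assms by (simp add: fourier_coeff_eq distrib_right integrable_mult_trig add_divide_distrib)

lemma fourier_coeff_cmult: "fourier_coeff (\<lambda>x. c * f x) k = c * fourier_coeff f k"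
  by (simp add: fourier_coeff_eq mult.assoc)

lemma norm_fourier_coeff_le:
  "norm (fourier_coeff f k) \<le> L_norm f / (2 * pi)"
proof -
  have "norm (LINT x|period_measure. f x * trig (- k) x) \<le> (LINT x|period_measure. norm (f x * trig (- k) x))"
    by (rule integral_norm_bound)
  also have "\<dots> = L_norm f" by (simp add: L_norm_eq norm_mult)
  finally show ?thesis by (simp add: fourier_coeff_eq norm_divide divide_right_mono)
qed

lemma L_norm_nonneg [simp]: "L_norm f \<ge> 0"
  by (simp add: L_norm_eq)

lemma L_norm_add_le:
  assumes "integrable period_measure f" "integrable period_measure g"
  shows "L_norm (\<lambda>x. f x + g x) \<le> L_norm f + L_norm g"
proof -
  have "L_norm (\<lambda>x. f x + g x) \<le> (LINT x|period_measure. norm (f x) + norm (g x))"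
    unfolding L_norm_eq using assms by (intro integral_mono) (auto intro: norm_triangle_ineq)
  thus ?thesis using assms by (simp add: L_norm_eq)
qed

lemma L_norm_cmult: "L_norm (\<lambda>x. c * f x) = norm c * L_norm f"
  by (simp add: L_norm_eq norm_mult)

lemma L_norm_minus_commute: "L_norm (\<lambda>x. f x - g x) = L_norm (\<lambda>x. g x - f x)"
  by (simp add: L_norm_eq norm_minus_commute)

lemma L_norm_triangle:
  assumes "integrable period_measure f" "integrable period_measure g" "integrable period_measure h"
  shows "L_norm (\<lambda>x. f x - h x) \<le> L_norm (\<lambda>x. f x - g x) + L_norm (\<lambda>x. g x - h x)"
  using L_norm_add_le[of "\<lambda>x. f x - g x" "\<lambda>x. g x - h x"] assms by simp

lemma L_norm_sum_le:
  assumes "\<And>i. i \<in> I \<Longrightarrow> integrable period_measure (f i)"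
  shows "L_norm (\<lambda>x. \<Sum>i\<in>I. f i x) \<le> (\<Sum>i\<in>I. L_norm (f i))"
  using assms
proof (induction I rule: infinite_finite_induct)
  case (insert i I)
  have "L_norm (\<lambda>x. f i x + (\<Sum>i\<in>I. f i x)) \<le> L_norm (f i) + L_norm (\<lambda>x. \<Sum>i\<in>I. f i x)"
    using insert.prems by (intro L_norm_add_le Bochner_Integration.integrable_sum) auto
  thus ?case using insert by fastforce
qed (auto simp: L_norm_eq)

section \<open>Trigonometric polynomials are dense\<close>

inductive trig_poly :: "(real \<Rightarrow> complex) \<Rightarrow> bool" where
  monomial: "trig_poly (\<lambda>x. c * trig k x)"
| add: "trig_poly p \<Longrightarrow> trig_poly q \<Longrightarrow> trig_poly (\<lambda>x. p x + q x)"

lemma trig_poly_integrable: "trig_poly p \<Longrightarrow> integrable period_measure p"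
  by (induction rule: trig_poly.induct) auto

lemma trig_poly_const: "trig_poly (\<lambda>x. c)"
  using trig_poly.monomial[of c 0] by simp

lemma trig_poly_mult:
  assumes "trig_poly p" "trig_poly q"
  shows "trig_poly (\<lambda>x. p x * q x)"
  using assms(1)
proof induction
  case (monomial c k)
  show ?case using assms(2)
  proof induction
    case (monomial d l)
    have "(\<lambda>x. c * trig k x * (d * trig l x)) = (\<lambda>x. (c * d) * trig (k + l) x)"
      by (simp add: trig_add fun_eq_iff)
    thus ?case using trig_poly.monomial by simp
  next
    case (add p q)
    thus ?case using trig_poly.add by (fastforce simp: distrib_left)
  qed
next
  case (add p q)
  thus ?case using trig_poly.add by (fastforce simp: distrib_right)
qed

lemma trig_poly_polynomial_on_circle:
  assumes "real_polynomial_function p"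
  shows "trig_poly (\<lambda>x. of_real (p (cis x)))"
  using assms
proof induction
  case (linear p)
  interpret bounded_linear p by fact
  have "p (cis x) = cos x * p 1 + sin x * p \<i>" for x
  proof -
    have "cis x = cos x *\<^sub>R 1 + sin x *\<^sub>R \<i>" by (simp add: complex_eq_iff)
    thus ?thesis by (simp add: add scaleR)
  qed
  moreover have "trig 1 x = cis x" "trig (-1) x = cis (- x)" for x
    by (simp_all add: trig_def cis_conv_exp)
  ultimately have "(\<lambda>x. complex_of_real (p (cis x))) =
      (\<lambda>x. Complex (p 1 / 2) (- p \<i> / 2) * trig 1 x + Complex (p 1 / 2) (p \<i> / 2) * trig (-1) x)"
    by (simp add: fun_eq_iff complex_eq_iff)
  thus ?case using trig_poly.add trig_poly.monomial by simp
next
  case (const c)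
  show ?case by (rule trig_poly_const)
next
  case (add p q)
  thus ?case using trig_poly.add by simp
next
  case (mult p q)
  thus ?case using trig_poly_mult by simp
qed

lemma cis_inj_period:
  assumes "cis x = cis y" "-pi < x" "x < pi" "-pi \<le> y" "y \<le> pi"
  shows "x = y"
proof -
  have "sin x = sin y \<and> cos x = cos y" using assms(1) by (simp add: complex_eq_iff)
  then obtain n :: int where n: "x = y + 2 * pi * n" using sin_cos_eq_iff by metis
  have "\<bar>2 * pi * n\<bar> < 2 * pi" using n assms by linarith
  hence "\<bar>real_of_int n\<bar> < 1" by (simp add: abs_mult)
  hence "n = 0" by linarith
  thus ?thesis using n by simp
qed

text \<open>Boundary values are the obstacle: a continuous function on the interval is a uniform limit of
  trigonometric polynomials only if it agrees at the two endpoints. Working on the unit circle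
  avoids this. Lebesgue regularity squeezes the set, with the endpoints removed, between a closed
  set \<open>K\<close> and an open set \<open>U\<close>; the images under \<open>cis\<close> of \<open>K\<close> and of
  the part of the period outside \<open>U\<close> are disjoint compact sets, so Urysohn's lemma gives a continuous function on the plane
  separating them, and Stone--Weierstrass approximates it on the circle by a polynomial in the
  real and imaginary parts.\<close>

lemma trig_poly_approximates_indicator:
  fixes c :: complex
  assumes A: "A \<in> sets period_measure" and e: "e > 0"
  shows "\<exists>p. trig_poly p \<and> L_norm (\<lambda>x. indicator A x *\<^sub>R c - p x) < e"
proof -
  \<comment> \<open>the uniform error on the period will contribute \<open>2 * pi * d\<close>, the exceptional set \<open>2 * d\<close>\<close>
  define d where "d = e / ((norm c + 1) * (2 * pi + 2))"
  have d: "d > 0" using e by (simp add: d_def add_nonneg_pos)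
  define A0 where "A0 = A \<inter> {-pi<..<pi}"
  have Al: "A \<in> sets lebesgue" and Asub: "A \<subseteq> {-pi..pi}"
    using A by (auto simp: sets_restrict_space)
  have A0: "A0 \<in> sets lebesgue" using Al by (auto simp: A0_def)
  obtain U where U: "open U" "A0 \<subseteq> U" "U - A0 \<in> lmeasurable" "emeasure lebesgue (U - A0) < ennreal d"
    using sets_lebesgue_outer_open[OF A0 d] by metis
  obtain K where K: "closed K" "K \<subseteq> A0" "A0 - K \<in> lmeasurable" "emeasure lebesgue (A0 - K) < ennreal d"
    using sets_lebesgue_inner_closed[OF A0 d] by metis
  have "bounded K" using K(2) by (intro bounded_subset[OF bounded_closed_interval[of "-pi" pi]]) (auto simp: A0_def)
  hence cK: "compact K" using K(1) compact_eq_bounded_closed by blast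
  have cU: "compact ({-pi..pi} - U)" using U(1) by (simp add: compact_diff)
  have clK: "closed (cis ` K)" and clU: "closed (cis ` ({-pi..pi} - U))"
    using cK cU by (auto intro!: compact_imp_closed compact_continuous_image continuous_intros)
  have disj: "cis ` K \<inter> cis ` ({-pi..pi} - U) = {}"
  proof -
    have "cis x \<noteq> cis y" if "x \<in> K" "y \<in> {-pi..pi} - U" for x y
    proof
      assume eq: "cis x = cis y"
      have x: "x \<in> A0" "-pi < x" "x < pi" using that K(2) by (auto simp: A0_def)
      hence "x = y" using that eq by (intro cis_inj_period) auto
      thus False using x U(2) that by auto
    qed
    thus ?thesis by (simp add: disjoint_iff_not_equal)
  qed
  obtain h :: "complex \<Rightarrow> real" where h: "continuous_on UNIV h" "\<And>z. h z \<in> closed_segment 1 0"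
     "\<And>z. z \<in> cis ` K \<Longrightarrow> h z = 1" "\<And>z. z \<in> cis ` ({-pi..pi} - U) \<Longrightarrow> h z = 0"
    using Urysohn_local[of UNIV "cis ` K" "cis ` ({-pi..pi} - U)" "1::real" 0] clK clU disj by auto
  have h01: "0 \<le> h z" "h z \<le> 1" for z using h(2)[of z] by (auto simp: closed_segment_eq_real_ivl)
  obtain p where p: "real_polynomial_function p" "\<And>z. z \<in> sphere 0 1 \<Longrightarrow> \<bar>h z - p z\<bar> < d"
    using Stone_Weierstrass_real_polynomial_function[of "sphere 0 1" h d] d h(1)
      continuous_on_subset[OF h(1)] by auto
  define q where "q x = c * of_real (p (cis x))" for x
  have q: "trig_poly q" unfolding q_def
    by (intro trig_poly_mult trig_poly_const trig_poly_polynomial_on_circle p)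
  define E where "E = ((U - A0) \<union> (A0 - K) \<union> {-pi, pi}) \<inter> {-pi..pi}"
  \<comment> \<open>the endpoints were removed from \<open>A\<close>, hence join the exceptional null set\<close>
  have pm: "{-pi, pi} \<in> lmeasurable" by (rule lmeasurable_compact[OF finite_imp_compact]) blast
  have Wl: "(U - A0) \<union> (A0 - K) \<union> {-pi, pi} \<in> lmeasurable"
    by (rule fmeasurable.Un[OF fmeasurable.Un[OF U(3) K(3)] pm])
  have El: "E \<in> lmeasurable" unfolding E_def
    by (rule fmeasurable_Int_fmeasurable[OF Wl]) simp
  have Esub: "E \<subseteq> {-pi..pi}" unfolding E_def by (rule Int_lower2)
  have ES: "E \<in> sets period_measure" 
    using fmeasurableD[OF El] Esub by (subst sets_restrict_space_iff) auto
  have mE: "measure lebesgue E \<le> 2 * d"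
  proof -
    have "measure lebesgue E \<le> measure lebesgue ((U - A0) \<union> (A0 - K) \<union> {-pi, pi})"
      
      by (rule measure_mono_fmeasurable[OF _ fmeasurableD[OF El] Wl]) (unfold E_def, rule Int_lower1)
    also have "\<dots> \<le> measure lebesgue ((U - A0) \<union> (A0 - K)) + measure lebesgue {-pi,pi}"
      by (rule measure_Un_le[OF sets.Un[OF fmeasurableD[OF U(3)] fmeasurableD[OF K(3)]] fmeasurableD[OF pm]])
    also have "measure lebesgue {-pi,pi} = 0"
      by (rule negligible_imp_measure0[OF negligible_finite]) blast
    also have "measure lebesgue ((U - A0) \<union> (A0 - K)) \<le> measure lebesgue (U - A0) + measure lebesgue (A0 - K)"
      by (rule measure_Un_le[OF fmeasurableD[OF U(3)] fmeasurableD[OF K(3)]])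
    also have "measure lebesgue (U - A0) \<le> d"
      unfolding measure_def by (rule enn2real_leI[OF less_imp_le[OF d] less_imp_le[OF U(4)]])
    also have "measure lebesgue (A0 - K) \<le> d"
      unfolding measure_def by (rule enn2real_leI[OF less_imp_le[OF d] less_imp_le[OF K(4)]])
    finally show ?thesis by simp
  qed
  \<comment> \<open>outside \<open>E\<close> the separating function is the indicator; inside, both lie in the unit interval\<close>
  have pt: "norm (indicator A x *\<^sub>R c - q x) \<le> norm c * (d + indicator E x)" if "x \<in> {-pi..pi}" for x
  proof -
    have "\<bar>indicator A x - h (cis x)\<bar> \<le> indicat_real E x"
    proof (cases "x \<in> E")
      case True thus ?thesis using h01[of "cis x"] by (auto simp: indicator_def)
    next
      case False
      hence x: "x \<noteq> -pi" "x \<noteq> pi" "x \<notin> U - A0" "x \<notin> A0 - K" using that by (auto simp: E_def)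
      show ?thesis
      proof (cases "x \<in> A")
        case True
        hence "x \<in> K" using x that by (auto simp: A0_def)
        thus ?thesis using h(3) True by simp
      next
        case False
        hence "x \<notin> U" using x by (auto simp: A0_def)
        thus ?thesis using h(4) that False by simp
      qed
    qed
    moreover have "\<bar>h (cis x) - p (cis x)\<bar> < d" by (intro p(2)) simp
    ultimately have *: "\<bar>indicator A x - p (cis x)\<bar> \<le> d + indicat_real E x" by linarith
    have "indicator A x *\<^sub>R c - q x = c * of_real (indicator A x - p (cis x))"
      by (simp add: q_def algebra_simps scaleR_conv_of_real)
    hence "norm (indicator A x *\<^sub>R c - q x) = norm c * \<bar>indicator A x - p (cis x)\<bar>"
      by (simp only: norm_mult norm_of_real)
    thus ?thesis using * by (simp add: mult_left_mono)
  qed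
  have iE: "integrable period_measure (indicat_real E)"
    using ES finite_measure.emeasure_finite[OF finite_measure_period, of E] by (simp add: less_top)
  have iA: "integrable period_measure (\<lambda>x. indicator A x *\<^sub>R c)"
    using A finite_measure.emeasure_finite[OF finite_measure_period, of A] by (simp add: less_top)
  have "L_norm (\<lambda>x. indicator A x *\<^sub>R c - q x) \<le> (LINT x|period_measure. norm c * (d + indicator E x))"
    unfolding L_norm_eq
  proof (rule integral_mono)
    show "integrable period_measure (\<lambda>x. norm (indicator A x *\<^sub>R c - q x))"
      using iA trig_poly_integrable[OF q] by auto
    show "integrable period_measure (\<lambda>x. norm c * (d + indicator E x))"
      using iE integrable_continuous_period[of "\<lambda>x. d"] by auto
  qed (use pt in auto)
  also have "\<dots> = norm c * ((LINT x|period_measure. d) + (LINT x|period_measure. indicator E x))"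
    using iE integrable_continuous_period[of "\<lambda>x. d"] by (subst Bochner_Integration.integral_mult_right_zero) simp
  also have "(LINT x|period_measure. d) = 2 * pi * d" by (simp add: measure_restrict_space)
  also have "(LINT x|period_measure. indicat_real E x) = measure lebesgue E"
    using ES by (subst Bochner_Integration.integral_indicator) (auto simp: measure_restrict_space sets_restrict_space intro!: arg_cong[of _ _ "measure lebesgue"])
  also have "norm c * (2 * pi * d + measure lebesgue E) \<le> norm c * (2 * pi * d + 2 * d)"
    using mE by (intro mult_left_mono) auto
  also have "\<dots> = norm c * (e / (norm c + 1))"
  proof -
    have "2 * pi + 2 \<noteq> 0" using pi_gt_zero by linarith
    hence "d * (2 * pi + 2) = e / (norm c + 1)" by (simp add: d_def)
    thus ?thesis by (simp add: algebra_simps)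
  qed
  also have "\<dots> = e * (norm c / (norm c + 1))" by simp
  also have "\<dots> < e * 1"
  proof (rule mult_strict_left_mono[OF _ e])
    have "0 < norm c + 1" by (rule add_nonneg_pos) auto
    thus "norm c / (norm c + 1) < 1" by simp
  qed
  also have "e * 1 = e" by simp
  finally show ?thesis using q by blast
qed

lemma trig_poly_dense:
  fixes f :: "real \<Rightarrow> complex"
  assumes "integrable period_measure f" "e > 0"
  shows "\<exists>p. trig_poly p \<and> L_norm (\<lambda>x. f x - p x) < e"
  using assms
proof (induction arbitrary: e rule: integrable_induct)
  case (base A c)
  thus ?case using trig_poly_approximates_indicator by blast
next
  case (add f g)
  obtain p where p: "trig_poly p" "L_norm (\<lambda>x. f x - p x) < e / 2" using add.IH(1)[of "e/2"] add.prems by auto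
  obtain q where q: "trig_poly q" "L_norm (\<lambda>x. g x - q x) < e / 2" using add.IH(2)[of "e/2"] add.prems by auto
  have "L_norm (\<lambda>x. (f x - p x) + (g x - q x)) \<le> L_norm (\<lambda>x. f x - p x) + L_norm (\<lambda>x. g x - q x)"
    using add.hyps p q trig_poly_integrable by (intro L_norm_add_le) auto
  hence "L_norm (\<lambda>x. (f x + g x) - (p x + q x)) < e" using p q by (simp add: algebra_simps)
  thus ?case using trig_poly.add[OF p(1) q(1)] by blast
next
  case (lim f s)
  have "(\<lambda>i. LINT x|period_measure. norm (s i x - f x)) \<longlonglongrightarrow> (LINT x|period_measure. 0)"
  proof (rule integral_dominated_convergence[where w = "\<lambda>x. 3 * norm (f x)"])
    show "AE x in period_measure. (\<lambda>i. norm (s i x - f x)) \<longlonglongrightarrow> 0"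
      using lim.hyps by (auto intro!: tendsto_norm_zero simp: LIM_zero)
    show "AE x in period_measure. norm (norm (s i x - f x)) \<le> 3 * norm (f x)" for i
      using lim.hyps(3) norm_triangle_ineq4 by (fastforce intro: order_trans)
  qed (use lim.hyps in auto)
  hence "(\<lambda>i. L_norm (\<lambda>x. s i x - f x)) \<longlonglongrightarrow> 0" by (simp add: L_norm_eq)
  hence "eventually (\<lambda>i. L_norm (\<lambda>x. s i x - f x) < e / 2) sequentially"
    using lim.prems by (intro order_tendstoD) auto
  then obtain i where i: "L_norm (\<lambda>x. s i x - f x) < e / 2" by (auto simp: eventually_sequentially)
  obtain p where p: "trig_poly p" "L_norm (\<lambda>x. s i x - p x) < e / 2" using lim.IH[of "e/2" i] lim.prems by auto
  have "L_norm (\<lambda>x. f x - p x) \<le> L_norm (\<lambda>x. f x - s i x) + L_norm (\<lambda>x. s i x - p x)"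
    using lim.hyps p trig_poly_integrable by (intro L_norm_triangle) auto
  thus ?case using i p L_norm_minus_commute[of f "s i"] by (intro exI[of _ p]) auto
qed

section \<open>Fejer means converge in the mean\<close>

lemma sum_symmetric_interval:
  "(\<Sum>k\<in>{- int n..int n}. g k) = g 0 + (\<Sum>j=1..n. g (int j) + g (- int j))"
  for g :: "int \<Rightarrow> 'a::ab_group_add"
proof (induction n)
  case (Suc n)
  have "{- int (Suc n)..int (Suc n)} = insert (- int (Suc n)) (insert (int (Suc n)) {- int n..int n})"
    by auto
  thus ?case using Suc by (simp add: algebra_simps)
qed simp

definition fejer_kernel :: "nat \<Rightarrow> real \<Rightarrow> real" where
  "fejer_kernel N y = (norm (\<Sum>j<N. trig (int j) y))\<^sup>2"

lemma fejer_kernel_nonneg: "fejer_kernel N y \<ge> 0"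
  by (simp add: fejer_kernel_def)

text \<open>The Fejer kernel is the square of the modulus of a geometric sum, because among the differences
  \<open>i - j\<close> with \<open>i, j < N\<close> each \<open>k\<close> occurs as often as it occurs in the Dirichlet kernels of
  order below \<open>N\<close>.\<close>

lemma sum_dirichlet_kernels:
  "(\<Sum>n<N. \<Sum>k\<in>{- int n..int n}. trig k y) = of_real (fejer_kernel N y)"
proof (induction N)
  case (Suc N)
  define G where "G = (\<Sum>j<N. trig (int j) y)"
  have sq: "of_real (fejer_kernel N y) = (\<Sum>j<N. trig (int j) y) * cnj (\<Sum>j<N. trig (int j) y)" for N
    unfolding fejer_kernel_def by (rule complex_norm_square)
  have "G * cnj (trig (int N) y) = (\<Sum>j<N. trig (int j - int N) y)"
    unfolding G_def cnj_trig sum_distrib_right trig_add[symmetric] by simp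
  also have "\<dots> = (\<Sum>j=1..N. trig (- int j) y)"
    by (rule sum.reindex_bij_witness[of _ "\<lambda>j. N - j" "\<lambda>j. N - j"]) (auto simp: of_nat_diff)
  finally have 1: "G * cnj (trig (int N) y) = (\<Sum>j=1..N. trig (- int j) y)" .
  have "trig (int N) y * cnj G = cnj (G * cnj (trig (int N) y))" by simp
  also have "\<dots> = (\<Sum>j=1..N. trig (int j) y)" unfolding 1 by (simp add: cnj_trig)
  finally have 2: "trig (int N) y * cnj G = (\<Sum>j=1..N. trig (int j) y)" .
  have 3: "trig (int N) y * cnj (trig (int N) y) = 1"
    unfolding cnj_trig trig_add[symmetric] by simp
  have "of_real (fejer_kernel (Suc N) y) = (G + trig (int N) y) * cnj (G + trig (int N) y)"
    unfolding sq G_def by simp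
  also have "\<dots> = G * cnj G + (trig (int N) y * cnj (trig (int N) y) + (trig (int N) y * cnj G + G * cnj (trig (int N) y)))"
    unfolding complex_cnj_add by (simp only: distrib_left distrib_right add_ac)
  also have "\<dots> = G * cnj G + (1 + (\<Sum>j=1..N. trig (int j) y + trig (- int j) y))"
    unfolding 1 2 3 sum.distrib ..
  also have "1 + (\<Sum>j=1..N. trig (int j) y + trig (- int j) y) = (\<Sum>k\<in>{- int N..int N}. trig k y)"
    by (subst sum_symmetric_interval) simp
  also have "G * cnj G = (\<Sum>n<N. \<Sum>k\<in>{- int n..int n}. trig k y)"
    unfolding Suc.IH sq G_def ..
  finally show ?case by (simp only: sum.lessThan_Suc)
qed (simp add: fejer_kernel_def)

text \<open>Without the usual factor \<open>1 / N\<close>, so that sums of partial sums over blocks of indices are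
  differences of Cesaro sums.\<close>

definition cesaro_sum :: "nat \<Rightarrow> (real \<Rightarrow> complex) \<Rightarrow> real \<Rightarrow> complex" where
  "cesaro_sum N f x = (\<Sum>n<N. fourier_sum n f x)"

lemma cesaro_sum_integrable [intro, simp]: "integrable period_measure (cesaro_sum N f)"
  unfolding cesaro_sum_def[abs_def] by (intro Bochner_Integration.integrable_sum) simp

lemma cesaro_sum_eq_integral:
  assumes f: "integrable period_measure f"
  shows "cesaro_sum N f x
    = (LINT t|period_measure. f t * of_real (fejer_kernel N (x - t))) / (2 * of_real pi)"
    and "integrable period_measure (\<lambda>t. f t * of_real (fejer_kernel N (x - t)))"
proof -
  have *: "f t * of_real (fejer_kernel N (x - t)) =
      (\<Sum>n<N. \<Sum>k\<in>{- int n..int n}. trig k x * (f t * trig (- k) t))" for t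
  proof -
    have "trig k (x - t) = trig k x * trig (- k) t" for k
      by (simp add: trig_def exp_add[symmetric] algebra_simps)
    thus ?thesis
      unfolding sum_dirichlet_kernels[symmetric] by (simp add: sum_distrib_left mult_ac)
  qed
  show "cesaro_sum N f x
    = (LINT t|period_measure. f t * of_real (fejer_kernel N (x - t))) / (2 * of_real pi)"
  proof -
    have "(LINT t|period_measure. f t * of_real (fejer_kernel N (x - t)))
        = (\<Sum>n<N. \<Sum>k\<in>{- int n..int n}. LINT t|period_measure. trig k x * (f t * trig (- k) t))"
      unfolding * using f
      by (subst Bochner_Integration.integral_sum, (auto intro!: Bochner_Integration.integrable_sum)[1],
          subst Bochner_Integration.integral_sum, (auto intro!: Bochner_Integration.integrable_sum)[1])
         (rule refl)
    also have "\<dots> = (\<Sum>n<N. \<Sum>k\<in>{- int n..int n}. 2 * of_real pi * (fourier_coeff f k * trig k x))"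
      by (intro sum.cong refl) (simp add: fourier_coeff_eq)
    finally show ?thesis
      by (simp add: cesaro_sum_def fourier_sum_eq sum_distrib_left[symmetric])
  qed
  show "integrable period_measure (\<lambda>t. f t * of_real (fejer_kernel N (x - t)))"
    unfolding * using f by (auto intro!: Bochner_Integration.integrable_sum)
qed

text \<open>Positivity of the kernel makes the Cesaro sums a monotone operation, so that the modulus may be
  moved inside.\<close>

lemma norm_cesaro_sum_le:
  assumes f: "integrable period_measure f"
  shows "norm (cesaro_sum N f x) \<le> Re (cesaro_sum N (\<lambda>t. of_real (norm (f t))) x)"
proof -
  let ?I = "\<lambda>g. LINT t|period_measure. g t * of_real (fejer_kernel N (x - t))"
  have "norm (?I f) \<le> (LINT t|period_measure. norm (f t * of_real (fejer_kernel N (x - t))))"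
    by (rule integral_norm_bound)
  also have "\<dots> = (LINT t|period_measure. norm (f t) * fejer_kernel N (x - t))"
    by (simp add: norm_mult fejer_kernel_nonneg)
  also have "\<dots> = Re (of_real \<dots>)" by simp
  also have "\<dots> = Re (?I (\<lambda>t. of_real (norm (f t))))"
    by (simp flip: of_real_mult)
  finally have "norm (?I f) \<le> Re (?I (\<lambda>t. of_real (norm (f t))))" .
  moreover have "Re (z / (2 * of_real pi)) = Re z / (2 * pi)" for z
    by (metis Re_divide_of_real of_real_mult of_real_numeral)
  ultimately show ?thesis using f
    by (simp add: cesaro_sum_eq_integral norm_divide divide_right_mono)
qed

text \<open>Every partial sum has the same mean as the function itself. Together with the previous
  pointwise bound this gives the contraction property of the Fejer means without any exchange of
  integrals.\<close>

lemma integral_cesaro_sum: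
  "(LINT x|period_measure. cesaro_sum N f x) = of_nat N * (LINT x|period_measure. f x)"
proof -
  have "(LINT x|period_measure. fourier_sum n f x) = (LINT x|period_measure. f x)" for n
  proof -
    have "(LINT x|period_measure. fourier_sum n f x)
        = (\<Sum>k\<in>{- int n..int n}. LINT x|period_measure. fourier_coeff f k * trig k x)"
      unfolding fourier_sum_eq by (rule Bochner_Integration.integral_sum) auto
    also have "\<dots> = (\<Sum>k\<in>{- int n..int n}. if k = 0 then fourier_coeff f 0 * (2 * of_real pi) else 0)"
      by (intro sum.cong refl) (simp add: integral_trig)
    also have "\<dots> = fourier_coeff f 0 * (2 * of_real pi)" by simp
    finally show ?thesis by (simp add: fourier_coeff_eq)
  qed
  thus ?thesis unfolding cesaro_sum_def
    by (subst Bochner_Integration.integral_sum) auto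
qed

lemma L_norm_cesaro_sum_le:
  assumes f: "integrable period_measure f"
  shows "L_norm (cesaro_sum N f) \<le> real N * L_norm f"
proof -
  let ?g = "\<lambda>t. complex_of_real (norm (f t))"
  have "L_norm (cesaro_sum N f) \<le> (LINT x|period_measure. Re (cesaro_sum N ?g x))"
    unfolding L_norm_eq using norm_cesaro_sum_le[OF f]
    by (intro integral_mono integrable_norm integrable_Re) auto
  also have "\<dots> = Re (LINT x|period_measure. cesaro_sum N ?g x)"
    by (subst integral_Re) auto
  also have "\<dots> = real N * L_norm f"
    by (simp add: integral_cesaro_sum L_norm_eq)
  finally show ?thesis .
qed

lemma cesaro_sum_linear:
  assumes "integrable period_measure f" "integrable period_measure g"
  shows "cesaro_sum N (\<lambda>x. f x + g x) x = cesaro_sum N f x + cesaro_sum N g x"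
  unfolding cesaro_sum_def fourier_sum_eq fourier_coeff_add[OF assms] distrib_right sum.distrib ..

lemma cesaro_sum_cmult: "cesaro_sum N (\<lambda>x. c * f x) x = c * cesaro_sum N f x"
  unfolding cesaro_sum_def fourier_sum_eq fourier_coeff_cmult sum_distrib_left mult.assoc ..

lemma cesaro_sum_trig: "cesaro_sum N (trig k) x = of_nat (N - nat \<bar>k\<bar>) * trig k x"
proof -
  have "fourier_sum n (trig k) x = (if nat \<bar>k\<bar> \<le> n then trig k x else 0)" for n
  proof -
    have "fourier_sum n (trig k) x = (\<Sum>j\<in>{- int n..int n}. if j = k then trig k x else 0)"
      unfolding fourier_sum_eq fourier_coeff_trig by (intro sum.cong) auto
    also have "\<dots> = (if k \<in> {- int n..int n} then trig k x else 0)" by (subst sum.delta) auto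
    also have "k \<in> {- int n..int n} \<longleftrightarrow> nat \<bar>k\<bar> \<le> n" by (simp add: nat_le_iff abs_le_iff) linarith
    finally show ?thesis .
  qed
  hence "cesaro_sum N (trig k) x = (\<Sum>n<N. if n \<in> {nat \<bar>k\<bar>..} then trig k x else 0)"
    unfolding cesaro_sum_def by (simp only: atLeast_iff)
  also have "\<dots> = (\<Sum>n\<in>{..<N} \<inter> {nat \<bar>k\<bar>..}. trig k x)"
    by (rule sum.inter_restrict[symmetric]) simp
  also have "{..<N} \<inter> {nat \<bar>k\<bar>..} = {nat \<bar>k\<bar>..<N}" by (simp add: set_eq_iff conj_commute)
  finally show ?thesis by simp
qed

text \<open>The Fejer means are contractions and converge on trigonometric polynomials, and these are
  dense.\<close>

theorem fejer_L1:
  assumes f: "integrable period_measure f"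
  shows "(\<lambda>N. L_norm (\<lambda>x. of_nat N * f x - cesaro_sum N f x) / real N) \<longlonglongrightarrow> 0"
proof -
  define D where "D f N = L_norm (\<lambda>x. of_nat N * f x - cesaro_sum N f x) / real N" for f and N :: nat
  have D_add: "D (\<lambda>x. f x + g x) N \<le> D f N + D g N"
    if "integrable period_measure f" "integrable period_measure g" for f g N
  proof -
    have "L_norm (\<lambda>x. (of_nat N * f x - cesaro_sum N f x) + (of_nat N * g x - cesaro_sum N g x))
      \<le> L_norm (\<lambda>x. of_nat N * f x - cesaro_sum N f x) + L_norm (\<lambda>x. of_nat N * g x - cesaro_sum N g x)"
      using that by (intro L_norm_add_le) auto
    hence "D (\<lambda>x. f x + g x) N \<le> (L_norm (\<lambda>x. of_nat N * f x - cesaro_sum N f x) + L_norm (\<lambda>x. of_nat N * g x - cesaro_sum N g x)) / real N"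
      unfolding D_def using that by (intro divide_right_mono) (auto simp: cesaro_sum_linear algebra_simps)
    thus ?thesis by (simp add: D_def add_divide_distrib)
  qed
  have D_nonneg: "D f N \<ge> 0" for f N by (simp add: D_def)
  have D_le: "D f N \<le> 2 * L_norm f" if "integrable period_measure f" for f N
  proof (cases "N = 0")
    case False
    have "L_norm (\<lambda>x. of_nat N * f x - cesaro_sum N f x)
      \<le> L_norm (\<lambda>x. of_nat N * f x) + L_norm (\<lambda>x. (-1) * cesaro_sum N f x)"
      using that L_norm_add_le[of "\<lambda>x. of_nat N * f x" "\<lambda>x. (-1) * cesaro_sum N f x"] by simp
    also have "\<dots> \<le> 2 * (real N * L_norm f)"
      unfolding L_norm_cmult using L_norm_cesaro_sum_le[OF that, of N] by (simp add: mult_ac)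
    finally show ?thesis using False by (simp add: D_def field_simps)
  qed (simp add: D_def)
  have poly: "D p \<longlonglongrightarrow> 0" if "trig_poly p" for p
    using that
  proof induction
    case (monomial c k)
    have "D (\<lambda>x. c * trig k x) N \<le> norm c * 2 * pi * real (nat \<bar>k\<bar>) / real N" for N
    proof -
      have "L_norm (\<lambda>x. of_nat N * (c * trig k x) - cesaro_sum N (\<lambda>x. c * trig k x) x)
          = L_norm (\<lambda>x. (c * of_nat (min N (nat \<bar>k\<bar>))) * trig k x)"
      proof -
        have "(of_nat N :: complex) = of_nat (N - nat \<bar>k\<bar>) + of_nat (min N (nat \<bar>k\<bar>))"
          unfolding of_nat_add[symmetric] by (rule arg_cong[of _ _ of_nat]) linarith
        thus ?thesis
          unfolding cesaro_sum_cmult cesaro_sum_trig by (simp only: algebra_simps) simp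
      qed
      also have "\<dots> = norm (c * of_nat (min N (nat \<bar>k\<bar>))) * L_norm (trig k)"
        by (rule L_norm_cmult)
      also have "L_norm (trig k) = 2 * pi" by (simp add: L_norm_eq measure_restrict_space)
      also have "norm (c * of_nat (min N (nat \<bar>k\<bar>))) * (2 * pi) = norm c * 2 * pi * real (min N (nat \<bar>k\<bar>))"
        by (simp only: norm_mult norm_of_nat mult_ac)
      finally have "D (\<lambda>x. c * trig k x) N = norm c * 2 * pi * real (min N (nat \<bar>k\<bar>)) / real N"
        by (simp only: D_def)
      also have "\<dots> \<le> norm c * 2 * pi * real (nat \<bar>k\<bar>) / real N"
        by (intro divide_right_mono mult_left_mono) auto
      finally show ?thesis .
    qed
    hence "eventually (\<lambda>N. norm (D (\<lambda>x. c * trig k x) N) \<le> norm c * 2 * pi * real (nat \<bar>k\<bar>) / real N) sequentially"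
      using D_nonneg by (intro always_eventually allI) simp
    thus ?case by (rule Lim_null_comparison[OF _ lim_const_over_n])
  next
    case (add p q)
    have "eventually (\<lambda>N. norm (D (\<lambda>x. p x + q x) N) \<le> D p N + D q N) sequentially"
      using D_add[OF trig_poly_integrable[OF add.hyps(1)] trig_poly_integrable[OF add.hyps(2)]] D_nonneg
      by (intro always_eventually allI) simp
    thus ?case by (rule Lim_null_comparison[OF _ tendsto_add_zero[OF add.IH]])
  qed
  have "D f \<longlonglongrightarrow> 0"
  proof (rule tendstoI)
    fix e :: real assume "e > 0"
    then obtain p where p: "trig_poly p" "L_norm (\<lambda>x. f x - p x) < e / 4"
      using trig_poly_dense[OF f, of "e/4"] by auto
    have "eventually (\<lambda>N. D p N < e / 2) sequentially"
      using poly[OF p(1)] \<open>e > 0\<close> by (intro order_tendstoD) auto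
    thus "eventually (\<lambda>N. dist (D f N) 0 < e) sequentially"
    proof eventually_elim
      case (elim N)
      have ip: "integrable period_measure p" by (rule trig_poly_integrable[OF p(1)])
      have "D f N \<le> D (\<lambda>x. f x - p x) N + D p N"
        using D_add[of "\<lambda>x. f x - p x" p N] f ip by simp
      also have "D (\<lambda>x. f x - p x) N \<le> 2 * L_norm (\<lambda>x. f x - p x)" using f ip by (intro D_le) auto
      finally show ?case using elim p(2) D_nonneg[of f N] by simp
    qed
  qed
  thus ?thesis by (simp only: D_def[abs_def])
qed

section \<open>Dirichlet sums and a discrete Hilbert transform\<close>

lemma jordan_inequality:
  assumes "0 \<le> y" "y \<le> pi / 2"
  shows "2 * y / pi \<le> sin y"
proof -
  have "concave_on {0..pi/2} sin"
  proof (rule f''_le0_imp_concave)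
    show "(sin has_real_derivative cos x) (at x)" "(cos has_real_derivative - sin x) (at x)" for x :: real
      by (auto intro!: derivative_eq_intros)
    show "- sin x \<le> 0" if "x \<in> {0..pi/2}" for x
      using that by (auto intro: sin_ge_zero)
  qed simp
  from concave_onD[OF this, of "2 * y / pi" 0 "pi/2"] assms
  show ?thesis by simp
qed

lemma norm_one_minus_cis_ge:
  assumes "\<bar>x\<bar> \<le> pi"
  shows "2 * \<bar>x\<bar> / pi \<le> norm (1 - cis x)"
proof -
  have "(norm (1 - cis x))\<^sup>2 = (1 - cos x)\<^sup>2 + (sin x)\<^sup>2"
    by (simp add: cmod_power2)
  also have "\<dots> = 2 - 2 * cos x"
    using sin_cos_squared_add[of x] by (simp add: power2_eq_square algebra_simps)
  also have "\<dots> = (2 * sin (\<bar>x\<bar> / 2))\<^sup>2"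
    using cos_double_sin[of "\<bar>x\<bar> / 2"] by (simp add: power_mult_distrib)
  finally have "(norm (1 - cis x))\<^sup>2 = (2 * sin (\<bar>x\<bar> / 2))\<^sup>2" .
  moreover have "sin (\<bar>x\<bar> / 2) \<ge> 0" using assms by (intro sin_ge_zero) auto
  ultimately have "norm (1 - cis x) = 2 * sin (\<bar>x\<bar> / 2)"
    by (intro power2_eq_imp_eq[of "norm (1 - cis x)"]) auto
  thus ?thesis using jordan_inequality[of "\<bar>x\<bar> / 2"] assms by simp
qed

text \<open>The sum is bounded by \<open>n\<close> and by \<open>pi / \<bar>x\<bar>\<close>. The single expression on the right dominates
  the minimum of these two numbers and has an elementary primitive, which avoids splitting the
  integral at \<open>1 / n\<close>.\<close>

lemma norm_dirichlet_le:
  assumes x: "\<bar>x\<bar> \<le> pi"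
  shows "norm (\<Sum>j<n. trig (int j) x) \<le> 2 * real n * pi / (real n * \<bar>x\<bar> + pi)"
proof -
  let ?G = "norm (\<Sum>j<n. trig (int j) x)"
  have "?G \<le> (\<Sum>j<n. norm (trig (int j) x))" by (rule norm_sum)
  hence 1: "?G * pi \<le> real n * pi" by (simp add: mult_right_mono)
  have "(1 - trig 1 x) * (\<Sum>j<n. trig (int j) x) = 1 - trig (int n) x"
    unfolding trig_of_nat using one_diff_power_eq[of "trig 1 x" n] by simp
  hence "norm (1 - trig 1 x) * ?G = norm (1 - trig (int n) x)" by (metis norm_mult)
  also have "\<dots> \<le> 2" using norm_triangle_ineq4[of 1 "trig (int n) x"] by simp
  finally have "norm (1 - cis x) * ?G \<le> 2" by (simp add: trig_def cis_conv_exp)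
  moreover have "2 * \<bar>x\<bar> / pi * ?G \<le> norm (1 - cis x) * ?G"
    by (intro mult_right_mono norm_one_minus_cis_ge x) auto
  ultimately have "2 * \<bar>x\<bar> / pi * ?G \<le> 2" by linarith
  hence "\<bar>x\<bar> * ?G \<le> pi" by (simp add: field_simps)
  hence "real n * (\<bar>x\<bar> * ?G) \<le> real n * pi" by (intro mult_left_mono) auto
  moreover have "?G * (real n * \<bar>x\<bar> + pi) = real n * (\<bar>x\<bar> * ?G) + ?G * pi" by (simp add: algebra_simps)
  ultimately have "?G * (real n * \<bar>x\<bar> + pi) \<le> 2 * real n * pi" using 1 by linarith
  moreover have "real n * \<bar>x\<bar> + pi > 0" by (intro add_nonneg_pos) auto
  ultimately show ?thesis by (simp add: field_simps)
qed

lemma L_norm_dirichlet_le: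
  "L_norm (\<lambda>x. \<Sum>j<n. trig (int j) x) \<le> 4 * pi * ln (real n + 1)"
proof -
  define g where "g x = 2 * real n * pi / (real n * \<bar>x\<bar> + pi)" for x
  have pos: "real n * t + pi > 0" if "t \<ge> 0" for t using that by (intro add_nonneg_pos) auto
  have "continuous_on {-pi..pi} g" unfolding g_def
    using pos by (intro continuous_intros) (auto simp: less_imp_neq[symmetric])
  hence ig: "integrable period_measure g" by (rule integrable_continuous_period)
  have "(g has_integral (2 * pi * ln (real n * pi + pi) - 2 * pi * ln (real n * 0 + pi))) {0..pi}"
  proof (rule fundamental_theorem_of_calculus)
    fix x :: real assume x: "x \<in> {0..pi}"
    have "((\<lambda>x. 2 * pi * ln (real n * x + pi)) has_real_derivative g x) (at x within {0..pi})"
      using x pos[of x] by (auto simp: g_def field_simps intro!: derivative_eq_intros)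
    thus "((\<lambda>x. 2 * pi * ln (real n * x + pi)) has_vector_derivative g x) (at x within {0..pi})"
      by (simp add: has_real_derivative_iff_has_vector_derivative)
  qed simp
  moreover have "(g has_integral (- (2 * pi * ln (- real n * 0 + pi)) - - (2 * pi * ln (- real n * - pi + pi)))) {-pi..0}"
  proof (rule fundamental_theorem_of_calculus)
    fix x :: real assume x: "x \<in> {-pi..0}"
    have "((\<lambda>x. - (2 * pi * ln (- real n * x + pi))) has_real_derivative g x) (at x within {-pi..0})"
      using x pos[of "-x"] by (auto simp: g_def field_simps intro!: derivative_eq_intros)
    thus "((\<lambda>x. - (2 * pi * ln (- real n * x + pi))) has_vector_derivative g x) (at x within {-pi..0})"
      by (simp add: has_real_derivative_iff_has_vector_derivative)
  qed simp
  ultimately have "(g has_integral ((- (2 * pi * ln (- real n * 0 + pi)) - - (2 * pi * ln (- real n * - pi + pi)))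
     + (2 * pi * ln (real n * pi + pi) - 2 * pi * ln (real n * 0 + pi)))) {-pi..pi}"
    by (intro has_integral_combine[of "-pi" 0 pi]) auto
  hence "(LINT x|period_measure. g x) = (- (2 * pi * ln (- real n * 0 + pi)) - - (2 * pi * ln (- real n * - pi + pi)))
     + (2 * pi * ln (real n * pi + pi) - 2 * pi * ln (real n * 0 + pi))"
    using ig by (subst lebesgue_integral_eq_integral) (auto simp: integral_unique)
  also have "\<dots> = 4 * pi * (ln (real n * pi + pi) - ln pi)" by (simp add: algebra_simps)
  also have "real n * pi + pi = (real n + 1) * pi" by (simp add: algebra_simps)
  also have "ln ((real n + 1) * pi) - ln pi = ln (real n + 1)" by (subst ln_mult) auto
  finally have "(LINT x|period_measure. g x) = 4 * pi * ln (real n + 1)" .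
  moreover have "L_norm (\<lambda>x. \<Sum>j<n. trig (int j) x) \<le> (LINT x|period_measure. g x)"
    unfolding L_norm_eq
  proof (rule integral_mono)
    show "norm (\<Sum>j<n. trig (int j) x) \<le> g x" if "x \<in> space period_measure" for x
      using that norm_dirichlet_le[of x n] by (auto simp: g_def)
  qed (intro ig integrable_norm Bochner_Integration.integrable_sum integrable_trig)+
  ultimately show ?thesis by simp
qed

text \<open>Shifting or conjugating a block of frequencies leaves the modulus of its sum unchanged. The sign
  \<open>s\<close> lets later estimates treat positive and negative frequencies at once.\<close>

lemma norm_trig_block:
  assumes "s \<in> {1, -1}"
  shows "norm (\<Sum>k=p..<q. trig (s * int k) x) = norm (\<Sum>j<q-p. trig (int j) x)"
proof -
  have *: "(\<Sum>k=p..<q. trig (int k) x) = trig (int p) x * (\<Sum>j<q-p. trig (int j) x)"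
    unfolding sum_distrib_left trig_add[symmetric]
    by (rule sum.reindex_bij_witness[of _ "\<lambda>j. j + p" "\<lambda>k. k - p"]) auto
  have "(\<Sum>k=p..<q. trig (- int k) x) = cnj (\<Sum>k=p..<q. trig (int k) x)"
    by (simp add: cnj_trig)
  thus ?thesis using assms * by (auto simp: norm_mult simp del: cnj_sum complex_cnj_mult)
qed

lemma summation_by_parts:
  fixes u e :: "nat \<Rightarrow> complex"
  assumes "p \<le> q"
  shows "(\<Sum>k=p..<q. u k * e k)
    = u q * (\<Sum>j=p..<q. e j) + (\<Sum>k=p..<q. seq_diff u k * (\<Sum>j=p..<Suc k. e j))"
  using assms
  by (induction q rule: dec_induct) (simp_all add: seq_diff_def algebra_simps)

text \<open>Summation by parts replaces the exponentials by Dirichlet sums, whose norms grow only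
  logarithmically in the length of the block.\<close>

lemma L_norm_block_le:
  assumes s: "s \<in> {1, -1}" and pq: "p \<le> q"
  shows "L_norm (\<lambda>x. \<Sum>k=p..<q. u k * trig (s * int k) x)
    \<le> (norm (u q) + (\<Sum>k=p..<q. norm (seq_diff u k))) * (4 * pi * ln (real (q - p) + 1))"
proof -
  define G where "G k = (\<lambda>x. \<Sum>j=p..<k. trig (s * int j) x)" for k
  let ?B = "4 * pi * ln (real (q - p) + 1)"
  have iG: "integrable period_measure (G k)" for k
    unfolding G_def by (intro Bochner_Integration.integrable_sum) auto
  have G: "L_norm (G k) \<le> ?B" if "k \<le> q" for k
  proof -
    have "L_norm (G k) = L_norm (\<lambda>x. \<Sum>j<k-p. trig (int j) x)"
      unfolding L_norm_eq G_def norm_trig_block[OF s] ..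
    also have "\<dots> \<le> 4 * pi * ln (real (k - p) + 1)" by (rule L_norm_dirichlet_le)
    also have "\<dots> \<le> ?B" using that by (intro mult_left_mono) auto
    finally show ?thesis .
  qed
  have "L_norm (\<lambda>x. \<Sum>k=p..<q. u k * trig (s * int k) x)
      = L_norm (\<lambda>x. u q * G q x + (\<Sum>k=p..<q. seq_diff u k * G (Suc k) x))"
    unfolding G_def summation_by_parts[OF pq, of u "\<lambda>k. trig (s * int k) _"] ..
  also have "\<dots> \<le> L_norm (\<lambda>x. u q * G q x) + L_norm (\<lambda>x. \<Sum>k=p..<q. seq_diff u k * G (Suc k) x)"
    using iG by (intro L_norm_add_le Bochner_Integration.integrable_sum) auto
  also have "L_norm (\<lambda>x. \<Sum>k=p..<q. seq_diff u k * G (Suc k) x)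
      \<le> (\<Sum>k=p..<q. L_norm (\<lambda>x. seq_diff u k * G (Suc k) x))"
    using iG by (intro L_norm_sum_le) auto
  also have "\<dots> \<le> (\<Sum>k=p..<q. norm (seq_diff u k) * ?B)"
    unfolding L_norm_cmult using G by (intro sum_mono mult_left_mono) auto
  also have "L_norm (\<lambda>x. u q * G q x) \<le> norm (u q) * ?B"
    unfolding L_norm_cmult using G by (intro mult_left_mono) auto
  finally show ?thesis by (simp add: distrib_right sum_distrib_right)
qed

text \<open>The bounded function whose Fourier coefficients are the Hilbert kernel \<open>1 / k\<close>, up to a factor.\<close>

definition sawtooth :: "real \<Rightarrow> complex" where
  "sawtooth x = of_real (if 0 \<le> x then pi - x else - pi - x)"

lemma sawtooth_measurable: "sawtooth \<in> borel_measurable period_measure"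
proof -
  have "sawtooth \<in> borel_measurable borel" unfolding sawtooth_def by measurable
  hence "sawtooth \<in> borel_measurable lebesgue" by (simp add: measurable_completion)
  thus ?thesis by (rule measurable_restrict_space1)
qed

lemma norm_sawtooth_le: "x \<in> {-pi..pi} \<Longrightarrow> norm (sawtooth x) \<le> pi"
  by (auto simp: sawtooth_def simp flip: of_real_diff of_real_minus)

lemma integrable_mult_sawtooth:
  "integrable period_measure f \<Longrightarrow> integrable period_measure (\<lambda>x. f x * sawtooth x)"
  using integrable_mult_bounded_period[OF _ sawtooth_measurable norm_sawtooth_le] .

lemma integral_sawtooth_trig:
  assumes "k \<noteq> 0"
  shows "(LINT x|period_measure. trig k x * sawtooth x) = 2 * of_real pi * \<i> / of_int k"
proof -
  \<comment> \<open>a primitive of \<open>trig k x * (c - x)\<close>; the sawtooth uses \<open>c = - pi\<close> left of 0 and \<open>c = pi\<close> right of it\<close>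
  define F where "F c x = (of_real c - of_real x) * trig k x / (\<i> * of_int k) - trig k x / (of_int k)\<^sup>2" for c x :: real
  have F: "(F c has_vector_derivative trig k x * of_real (c - x)) (at x within A)" for c x A
    using assms unfolding F_def trig_def
    by (auto intro!: derivative_eq_intros has_vector_derivative_real_field simp: field_simps power2_eq_square)
  have "((\<lambda>x. trig k x * of_real (pi - x)) has_integral (F pi pi - F pi 0)) {0..pi}"
    by (intro fundamental_theorem_of_calculus F) auto
  hence 1: "((\<lambda>x. trig k x * sawtooth x) has_integral (F pi pi - F pi 0)) {0..pi}"
    by (rule has_integral_eq[rotated]) (auto simp: sawtooth_def)
  have "((\<lambda>x. trig k x * of_real (- pi - x)) has_integral (F (-pi) 0 - F (-pi) (-pi))) {-pi..0}"
    by (intro fundamental_theorem_of_calculus F) auto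
  hence 2: "((\<lambda>x. trig k x * sawtooth x) has_integral (F (-pi) 0 - F (-pi) (-pi))) {-pi..0}"
    by (rule has_integral_spike_finite[of "{0}", rotated 2]) (auto simp: sawtooth_def)
  have "((\<lambda>x. trig k x * sawtooth x) has_integral ((F (-pi) 0 - F (-pi) (-pi)) + (F pi pi - F pi 0))) {-pi..pi}"
    by (rule has_integral_combine[OF _ _ 2 1]) auto
  also have "F (-pi) 0 - F (-pi) (-pi) + (F pi pi - F pi 0) = - (2 * of_real pi / (\<i> * of_int k))"
    by (simp add: F_def trig_minus_pi trig_def[of k 0])
  also have "\<dots> = 2 * of_real pi * \<i> / of_int k"
    using assms by (simp add: field_simps)
  finally have "((\<lambda>x. trig k x * sawtooth x) has_integral (2 * of_real pi * \<i> / of_int k)) {-pi..pi}" .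
  moreover have "integrable period_measure (\<lambda>x. trig k x * sawtooth x)"
    by (intro integrable_mult_sawtooth) simp
  ultimately show ?thesis by (simp add: lebesgue_integral_eq_integral integral_unique)
qed

text \<open>Integrating a trigonometric polynomial against the sawtooth, modulated to frequency \<open>m\<close>,
  produces the discrete Hilbert transform of its coefficients at \<open>m\<close>, and the sawtooth is bounded
  by \<open>pi\<close>.\<close>

lemma norm_hilbert_sum_le:
  assumes "finite A" "m \<notin> A"
  shows "norm (\<Sum>k\<in>A. c k / of_int (k - m)) \<le> L_norm (\<lambda>x. \<Sum>k\<in>A. c k * trig k x) / 2"
proof -
  define T where "T x = (\<Sum>k\<in>A. c k * trig k x)" for x
  have iT: "integrable period_measure T"
    unfolding T_def by (intro Bochner_Integration.integrable_sum) auto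
  have "(LINT x|period_measure. T x * trig (- m) x * sawtooth x)
      = (LINT x|period_measure. (\<Sum>k\<in>A. c k * (trig (k - m) x * sawtooth x)))"
    using trig_add[of _ "- m"] by (simp add: T_def sum_distrib_left sum_distrib_right mult_ac)
  also have "\<dots> = (\<Sum>k\<in>A. c k * (LINT x|period_measure. trig (k - m) x * sawtooth x))"
    using integrable_mult_sawtooth[of "trig _"] by (subst Bochner_Integration.integral_sum) auto
  also have "\<dots> = (\<Sum>k\<in>A. 2 * of_real pi * \<i> * (c k / of_int (k - m)))"
  proof (intro sum.cong refl)
    fix k assume "k \<in> A"
    hence "k - m \<noteq> 0" using assms by auto
    from integral_sawtooth_trig[OF this]
    show "c k * (LINT x|period_measure. trig (k - m) x * sawtooth x)
        = 2 * of_real pi * \<i> * (c k / of_int (k - m))" by simp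
  qed
  also have "\<dots> = 2 * of_real pi * \<i> * (\<Sum>k\<in>A. c k / of_int (k - m))"
    by (simp add: sum_distrib_left)
  finally have eq: "(LINT x|period_measure. T x * trig (- m) x * sawtooth x)
    = 2 * of_real pi * \<i> * (\<Sum>k\<in>A. c k / of_int (k - m))" .
  have "norm (LINT x|period_measure. T x * trig (- m) x * sawtooth x)
      \<le> (LINT x|period_measure. norm (T x * trig (- m) x * sawtooth x))"
    by (rule integral_norm_bound)
  also have "\<dots> \<le> (LINT x|period_measure. norm (T x) * pi)"
    using iT integrable_mult_sawtooth[OF integrable_mult_trig[OF iT]] norm_sawtooth_le
    by (intro integral_mono integrable_norm) (auto simp: norm_mult intro!: mult_left_mono)
  also have "\<dots> = L_norm T * pi" by (simp add: L_norm_eq)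
  finally have "2 * pi * norm (\<Sum>k\<in>A. c k / of_int (k - m)) \<le> L_norm T * pi"
    unfolding eq by (simp add: norm_mult)
  thus ?thesis by (simp add: T_def[abs_def])
qed

section \<open>From Cesaro means to partial sums\<close>

lemma fourier_sum_diff:
  assumes "p \<le> q"
  shows "fourier_sum q f x - fourier_sum p f x =
    (\<Sum>k=Suc p..<Suc q. fourier_coeff f (int k) * trig (int k) x)
    + (\<Sum>k=Suc p..<Suc q. fourier_coeff f (- int k) * trig (- int k) x)"
proof -
  define g where "g k = fourier_coeff f k * trig k x" for k
  have S: "fourier_sum n f x = g 0 + (\<Sum>j=1..<Suc n. g (int j) + g (- int j))" for n
    unfolding fourier_sum_eq g_def[symmetric] sum_symmetric_interval atLeastLessThanSuc_atLeastAtMost ..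
  have "(\<Sum>j=1..<Suc p. g (int j) + g (- int j)) + (\<Sum>j=Suc p..<Suc q. g (int j) + g (- int j))
      = (\<Sum>j=1..<Suc q. g (int j) + g (- int j))"
    using assms by (intro sum.atLeastLessThan_concat) auto
  thus ?thesis unfolding S g_def[symmetric] sum.distrib by (simp only: algebra_simps)
qed

lemma L_norm_fourier_sum_diff_le:
  fixes f :: "real \<Rightarrow> complex"
  defines "a \<equiv> \<lambda>k. fourier_coeff f (int k)" and "b \<equiv> \<lambda>k. fourier_coeff f (- int k)"
  assumes pq: "p \<le> q"
  shows "L_norm (\<lambda>x. fourier_sum q f x - fourier_sum p f x)
    \<le> (norm (a (Suc q)) + norm (b (Suc q))
       + (\<Sum>k=Suc p..<Suc q. norm (seq_diff a k)) + (\<Sum>k=Suc p..<Suc q. norm (seq_diff b k)))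
      * (4 * pi * ln (real (q - p) + 1))"
proof -
  let ?A = "\<lambda>x. \<Sum>k=Suc p..<Suc q. a k * trig (1 * int k) x"
  let ?B = "\<lambda>x. \<Sum>k=Suc p..<Suc q. b k * trig (- 1 * int k) x"
  let ?l = "4 * pi * ln (real (q - p) + 1)"
  have "L_norm (\<lambda>x. fourier_sum q f x - fourier_sum p f x) = L_norm (\<lambda>x. ?A x + ?B x)"
    unfolding fourier_sum_diff[OF pq] a_def b_def by simp
  also have "\<dots> \<le> L_norm ?A + L_norm ?B"
    by (intro L_norm_add_le Bochner_Integration.integrable_sum integrable_mult_right integrable_trig)
  also have "L_norm ?A \<le> (norm (a (Suc q)) + (\<Sum>k=Suc p..<Suc q. norm (seq_diff a k))) * ?l"
    using L_norm_block_le[of 1 "Suc p" "Suc q" a] pq by simp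
  also have "L_norm ?B \<le> (norm (b (Suc q)) + (\<Sum>k=Suc p..<Suc q. norm (seq_diff b k))) * ?l"
    using L_norm_block_le[of "-1" "Suc p" "Suc q" b] pq by simp
  finally show ?thesis by (simp add: algebra_simps)
qed

text \<open>A Tauberian principle. The average of the partial sums with index from \<open>n\<close> to about
  \<open>lam * n\<close> is a combination of two Fejer means with bounded weights, so it tends to \<open>f\<close>; and the
  partial sum of order \<open>n\<close> differs from that average by at most the oscillation over the block.\<close>

lemma fourier_sum_converges_if_slowly_oscillating:
  assumes f: "integrable period_measure f"
    and osc: "\<And>e. e > 0 \<Longrightarrow> \<exists>lam>1. eventually (\<lambda>n. \<forall>j\<in>{n..<nat \<lfloor>lam * real n\<rfloor>}.
       L_norm (\<lambda>x. fourier_sum j f x - fourier_sum n f x) \<le> e) sequentially"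
  shows "(\<lambda>n. L_norm (\<lambda>x. f x - fourier_sum n f x)) \<longlonglongrightarrow> 0"
proof (rule tendstoI)
  fix e0 :: real assume "e0 > 0"
  define e where "e = e0 / 3"
  have e: "e > 0" using \<open>e0 > 0\<close> by (simp add: e_def)
  obtain lam where lam: "lam > 1" and ev: "eventually (\<lambda>n. \<forall>j\<in>{n..<nat \<lfloor>lam * real n\<rfloor>}.
       L_norm (\<lambda>x. fourier_sum j f x - fourier_sum n f x) \<le> e) sequentially"
    using osc[OF e] by blast
  define D where "D N = L_norm (\<lambda>x. of_nat N * f x - cesaro_sum N f x)" for N :: nat
  \<comment> \<open>at this precision the two Fejer means, whose weights add up to about \<open>(lam + 1) / (lam - 1)\<close>, contribute no more than \<open>e\<close>\<close>
  define h where "h = e * (lam - 1) / (2 * (lam + 1))"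
  have h: "h > 0" using e lam by (simp add: h_def)
  have "eventually (\<lambda>N. D N / real N < h) sequentially"
    using fejer_L1[OF f] h unfolding D_def by (intro order_tendstoD(2)) auto
  then obtain n0 where n0: "\<And>N. N \<ge> n0 \<Longrightarrow> D N / real N < h"
    by (auto simp: eventually_sequentially)
  have D_le: "D N \<le> h * real N" if "N \<ge> n0" "N > 0" for N
    using n0[OF that(1)] that(2) by (simp add: field_simps)
  have "eventually (\<lambda>n. n \<ge> max (max n0 1) (nat \<lceil>2 / (lam - 1)\<rceil>)) sequentially"
    by (rule eventually_ge_at_top)
  with ev show "eventually (\<lambda>n. dist (L_norm (\<lambda>x. f x - fourier_sum n f x)) 0 < e0) sequentially"
  proof eventually_elim
    case (elim n)
    define N where "N = nat \<lfloor>lam * real n\<rfloor>"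
    have n: "n \<ge> n0" "n \<ge> 1" "real n \<ge> 2 / (lam - 1)" using elim(2) by linarith+
    have 1: "(lam - 1) * real n \<ge> 2" using n(3) lam by (simp add: field_simps)
    have N: "real N \<le> lam * real n" "real N > lam * real n - 1"
      unfolding N_def using lam by (auto intro!: of_nat_floor)
    have Nn: "real N - real n \<ge> (lam - 1) * real n / 2"
      using N 1 left_diff_distrib[of lam 1 "real n"] by linarith
    have "n < N" using Nn 1 by linarith
    \<comment> \<open>differences of Cesaro sums are sums of partial sums, so the average over the block is expressed by the two Cesaro sums\<close>
    have split: "of_nat (N - n) * (f x - fourier_sum n f x)
      = ((of_nat N * f x - cesaro_sum N f x) - (of_nat n * f x - cesaro_sum n f x))
         + (\<Sum>j=n..<N. fourier_sum j f x - fourier_sum n f x)" for x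
    proof -
      have "cesaro_sum N f x = cesaro_sum n f x + (\<Sum>j=n..<N. fourier_sum j f x)"
        unfolding cesaro_sum_def lessThan_atLeast0 using \<open>n < N\<close>
        by (intro sum.atLeastLessThan_concat[symmetric]) auto
      thus ?thesis using \<open>n < N\<close> by (simp add: sum_subtractf of_nat_diff algebra_simps)
    qed
    have "real (N - n) * L_norm (\<lambda>x. f x - fourier_sum n f x)
        = L_norm (\<lambda>x. of_nat (N - n) * (f x - fourier_sum n f x))"
      unfolding L_norm_cmult by simp
    also have "\<dots> \<le> L_norm (\<lambda>x. (of_nat N * f x - cesaro_sum N f x) - (of_nat n * f x - cesaro_sum n f x))
         + L_norm (\<lambda>x. \<Sum>j=n..<N. fourier_sum j f x - fourier_sum n f x)"
      unfolding split using f by (intro L_norm_add_le Bochner_Integration.integrable_sum) auto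
    also have "L_norm (\<lambda>x. (of_nat N * f x - cesaro_sum N f x) - (of_nat n * f x - cesaro_sum n f x))
        \<le> D N + D n"
      using L_norm_triangle[of "\<lambda>x. of_nat N * f x - cesaro_sum N f x" "\<lambda>x. 0" "\<lambda>x. of_nat n * f x - cesaro_sum n f x"]
         f L_norm_minus_commute[of "\<lambda>x. of_nat n * f x" "cesaro_sum n f"] by (simp add: D_def)
    also have "D N + D n \<le> h * (real N + real n)"
      using D_le[of N] D_le[of n] n \<open>n < N\<close> by (simp add: distrib_left)
    also have "\<dots> \<le> h * ((lam + 1) * real n)"
      using N h by (intro mult_left_mono) (auto simp: algebra_simps)
    also have "\<dots> = e * ((lam - 1) * real n / 2)"
      using lam by (simp add: h_def divide_simps)
    also have "\<dots> \<le> e * real (N - n)" using Nn e \<open>n < N\<close> by (intro mult_left_mono) auto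
    also have "L_norm (\<lambda>x. \<Sum>j=n..<N. fourier_sum j f x - fourier_sum n f x)
        \<le> (\<Sum>j=n..<N. L_norm (\<lambda>x. fourier_sum j f x - fourier_sum n f x))"
      by (intro L_norm_sum_le) auto
    also have "\<dots> \<le> (\<Sum>j=n..<N. e)" using elim(1) by (intro sum_mono) (auto simp: N_def)
    finally have "real (N - n) * L_norm (\<lambda>x. f x - fourier_sum n f x) \<le> real (N - n) * (2 * e)"
      by (simp add: algebra_simps)
    hence "L_norm (\<lambda>x. f x - fourier_sum n f x) \<le> 2 * e" using \<open>n < N\<close> by simp
    thus ?case using e by (simp add: e_def)
  qed
qed

section \<open>Variation bounds and short windows\<close>

lemma GBV_block_le:
  fixes c :: "nat \<Rightarrow> complex"
  assumes var: "(\<Sum>n=k..2*k. norm (seq_diff c n)) \<le> M * Max ((\<lambda>n. norm (c n)) ` {k..<k + N})"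
    and "M > 0" "N \<ge> 1" "\<And>n. n \<ge> k \<Longrightarrow> norm (c n) \<le> B"
  shows "(\<Sum>n=k..2*k. norm (seq_diff c n)) \<le> M * B"
proof -
  have "Max ((\<lambda>n. norm (c n)) ` {k..<k + N}) \<le> B"
    using assms by (intro Max.boundedI) auto
  thus ?thesis using var \<open>M > 0\<close> mult_left_mono[of _ B M] by (meson less_imp_le order_trans)
qed

lemma norm_seq_diff_telescope:
  assumes "k \<le> m"
  shows "norm (c k - c m) \<le> (\<Sum>j=k..<m. norm (seq_diff c j))"
proof -
  have "c k - c m = (\<Sum>j=k..<m. seq_diff c j)"
    using assms by (induction m rule: dec_induct) (auto simp: seq_diff_def algebra_simps)
  thus ?thesis by (simp add: norm_sum)
qed

text \<open>Hilbert sums are taken over the indices from \<open>window m\<close> to \<open>m - 1\<close>. A window of length about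
  \<open>sqrt m\<close> is a compromise: it is long enough for the sum of the weights \<open>1 / (m - k)\<close> to be at
  least half of \<open>ln m\<close>, and so short that, for any \<open>lam > 1\<close> and
  large \<open>m\<close>, it lies in a block from \<open>n\<close> to \<open>lam * n\<close>, and that frequencies of the opposite sign contribute only \<open>O(1 / sqrt m)\<close>.\<close>

definition window :: "nat \<Rightarrow> nat" where
  "window m = m - nat \<lfloor>sqrt (real m)\<rfloor>"

definition harm_window :: "nat \<Rightarrow> real" where
  "harm_window m = (\<Sum>k=window m..<m. 1 / real (m - k))"

lemma window_le: "window m \<le> m"
  by (simp add: window_def)

lemma m_minus_window: "m - window m = nat \<lfloor>sqrt (real m)\<rfloor>"
proof -
  have "sqrt (real m) \<le> real m"
    by (cases "m = 0") (auto intro!: real_le_lsqrt simp: power2_eq_square)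
  hence "nat \<lfloor>sqrt (real m)\<rfloor> \<le> m" by linarith
  thus ?thesis by (simp add: window_def)
qed

lemma m_minus_window_le_sqrt: "real (m - window m) \<le> sqrt (real m)"
  unfolding m_minus_window by (rule of_nat_floor) simp

lemma harm_window_ge:
  assumes "m \<ge> 1"
  shows "harm_window m \<ge> ln (real m) / 2"
proof -
  have "harm_window m = (\<Sum>i=1..m - window m. 1 / real i)"
    unfolding harm_window_def
    by (rule sum.reindex_bij_witness[of _ "\<lambda>i. m - i" "\<lambda>k. m - k"]) auto
  also have "\<dots> = harm (m - window m)" by (simp add: harm_def inverse_eq_divide)
  also have "\<dots> \<ge> ln (real (m - window m) + 1)" by (rule harm_ge_ln)
  also have "ln (sqrt (real m)) \<le> ln (real (m - window m) + 1)"
  proof (subst ln_le_cancel_iff)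
    show "sqrt (real m) \<le> real (m - window m) + 1" unfolding m_minus_window by linarith
  qed (use assms in auto)
  finally show ?thesis using assms by (simp add: ln_sqrt)
qed

lemma eventually_le_mult_window:
  assumes "lam > 1"
  shows "eventually (\<lambda>m. real m \<le> lam * real (window m)) sequentially"
  using eventually_ge_at_top[of "nat \<lceil>(lam / (lam - 1))\<^sup>2\<rceil>"]
proof eventually_elim
  case (elim m)
  hence "(lam / (lam - 1))\<^sup>2 \<le> real m" by linarith
  hence "lam / (lam - 1) \<le> sqrt (real m)" by (rule real_le_rsqrt)
  hence "lam \<le> (lam - 1) * sqrt (real m)" using assms by (simp add: field_simps)
  hence "lam * sqrt (real m) \<le> (lam - 1) * sqrt (real m) * sqrt (real m)" by (intro mult_right_mono) auto
  hence *: "lam * sqrt (real m) \<le> (lam - 1) * real m" by (simp add: mult.assoc)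
  have "lam * (real m - sqrt (real m)) \<le> lam * real (window m)"
    using m_minus_window_le_sqrt[of m] window_le[of m] assms by (intro mult_left_mono) (auto simp: of_nat_diff)
  thus ?case using * by (simp add: algebra_simps)
qed

lemma eventually_window_ge: "eventually (\<lambda>m. window m \<ge> n) sequentially"
proof -
  have "eventually (\<lambda>m. real m \<le> 2 * real (window m)) sequentially"
    by (rule eventually_le_mult_window) simp
  thus ?thesis using eventually_ge_at_top[of "2 * n"] by eventually_elim simp
qed

lemma eventually_ln_window_ge: "eventually (\<lambda>m. ln (real (window m)) \<ge> ln (real m) / 2) sequentially"
proof -
  have "eventually (\<lambda>m. real m \<le> 2 * real (window m)) sequentially"
    by (rule eventually_le_mult_window) simp
  thus ?thesis using eventually_ge_at_top[of 4]
  proof eventually_elim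
    case (elim m)
    have "2 \<le> sqrt (real m)" using elim by (intro real_le_rsqrt) auto
    hence "2 * sqrt (real m) \<le> sqrt (real m) * sqrt (real m)" by (intro mult_right_mono) auto
    hence "sqrt (real m) \<le> real (window m)" using elim by simp
    hence "ln (sqrt (real m)) \<le> ln (real (window m))" using elim by (subst ln_le_cancel_iff) auto
    thus ?case using elim by (simp add: ln_sqrt)
  qed
qed

section \<open>Logarithmic decay from mean convergence\<close>

text \<open>The difference of two partial sums contains both signs of frequencies. Those of the sign under
  consideration produce the Hilbert sum; the others lie at distance at least \<open>m\<close> from the test
  frequency and are absorbed by the last term.\<close>

lemma norm_hilbert_block_le:
  assumes s: "s \<in> {1, -1}" and p: "1 \<le> p" "p \<le> m"
    and B: "\<And>k. norm (fourier_coeff f k) \<le> B"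
  shows "norm (\<Sum>k=p..<m. fourier_coeff f (s * int k) / of_nat (m - k))
    \<le> L_norm (\<lambda>x. fourier_sum (m - 1) f x - fourier_sum (p - 1) f x) / 2 + B * real (m - p) / real m"
proof -
  define A where "A = (\<lambda>k. s * int k) ` {p..<m} \<union> (\<lambda>k. - s * int k) ` {p..<m}"
  have inj: "inj_on (\<lambda>k. t * int k) {p..<m}" if "t \<in> {1, -1}" for t
    using that by (auto simp: inj_on_def)
  have split: "(\<Sum>k\<in>A. g k) = (\<Sum>k=p..<m. g (s * int k)) + (\<Sum>k=p..<m. g (- s * int k))" for g :: "int \<Rightarrow> complex"
    unfolding A_def
  proof (subst sum.union_disjoint)
    show "(\<lambda>k. s * int k) ` {p..<m} \<inter> (\<lambda>k. - s * int k) ` {p..<m} = {}"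
      using s p by auto
    show "sum g ((\<lambda>k. s * int k) ` {p..<m}) + sum g ((\<lambda>k. - s * int k) ` {p..<m})
      = (\<Sum>k=p..<m. g (s * int k)) + (\<Sum>k=p..<m. g (- s * int k))"
      using inj[of s] inj[of "- s"] s by (simp only: sum.reindex) (auto simp: sum.reindex)
  qed auto
  have sgn: "x / (- of_int s * y) = - of_int s * (x / y)" for x y :: complex
    using s by auto
  let ?S1 = "\<Sum>k=p..<m. fourier_coeff f (s * int k) / of_nat (m - k)"
  let ?S2 = "\<Sum>k=p..<m. fourier_coeff f (- s * int k) / of_nat (m + k)"
  have "(\<Sum>k\<in>A. fourier_coeff f k / of_int (k - s * int m)) = - of_int s * (?S1 + ?S2)"
  proof -
    have "fourier_coeff f (s * int k) / of_int (s * int k - s * int m)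
        = - of_int s * (fourier_coeff f (s * int k) / of_nat (m - k))" if "k \<in> {p..<m}" for k
      using s that by (auto simp: of_nat_diff field_simps)
    moreover have "fourier_coeff f (- s * int k) / of_int (- s * int k - s * int m)
        = - of_int s * (fourier_coeff f (- s * int k) / of_nat (m + k))" if "k \<in> {p..<m}" for k
    proof -
      have eq: "of_int (- s * int k - s * int m) = - of_int s * (of_nat (m + k) :: complex)"
        by (simp add: algebra_simps)
      show ?thesis unfolding eq by (rule sgn)
    qed
    ultimately show ?thesis
      unfolding split distrib_left sum_distrib_left by (intro arg_cong2[of _ _ _ _ "(+)"] sum.cong refl) auto
  qed
  hence "norm (?S1 + ?S2) = norm (\<Sum>k\<in>A. fourier_coeff f k / of_int (k - s * int m))"
    using s by (auto simp: norm_mult norm_minus_commute)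
  also have "\<dots> \<le> L_norm (\<lambda>x. \<Sum>k\<in>A. fourier_coeff f k * trig k x) / 2"
  proof (rule norm_hilbert_sum_le)
    show "s * int m \<notin> A" using s p by (auto simp: A_def)
  qed (simp add: A_def)
  also have "(\<lambda>x. \<Sum>k\<in>A. fourier_coeff f k * trig k x) = (\<lambda>x. fourier_sum (m - 1) f x - fourier_sum (p - 1) f x)"
    using p s by (subst fourier_sum_diff) (auto simp: split fun_eq_iff)
  finally have 1: "norm (?S1 + ?S2) \<le> L_norm (\<lambda>x. fourier_sum (m - 1) f x - fourier_sum (p - 1) f x) / 2" .
  have "norm ?S2 \<le> (\<Sum>k=p..<m. norm (fourier_coeff f (- s * int k) / of_nat (m + k)))" by (rule norm_sum)
  also have "\<dots> \<le> (\<Sum>k=p..<m. B / real m)"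
  proof (rule sum_mono)
    fix k assume "k \<in> {p..<m}"
    hence "m > 0" using p by auto
    have "norm (fourier_coeff f (- s * int k)) / real (m + k) \<le> B / real m"
      using B[of "- s * int k"] \<open>m > 0\<close> by (intro frac_le) (auto intro: order_trans[OF norm_ge_zero])
    moreover have "norm (complex_of_nat (m + k)) = real (m + k)" by (rule norm_of_nat)
    ultimately show "norm (fourier_coeff f (- s * int k) / of_nat (m + k)) \<le> B / real m"
      by (simp only: norm_divide)
  qed
  also have "\<dots> = B * real (m - p) / real m" by simp
  finally have 2: "norm ?S2 \<le> B * real (m - p) / real m" .
  have "norm ?S1 \<le> norm (?S1 + ?S2) + norm ?S2"
    using norm_triangle_ineq4[of "?S1 + ?S2" ?S2] by simp
  with 1 2 show ?thesis by linarith
qed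

lemma hilbert_window_tendsto_0:
  assumes f: "integrable period_measure f"
    and conv: "(\<lambda>n. L_norm (\<lambda>x. f x - fourier_sum n f x)) \<longlonglongrightarrow> 0"
    and s: "s \<in> {1, -1}"
  shows "(\<lambda>m. \<Sum>k=window m..<m. fourier_coeff f (s * int k) / of_nat (m - k)) \<longlonglongrightarrow> 0"
proof -
  define B where "B = L_norm f / (2 * pi)"
  define E where "E n = L_norm (\<lambda>x. f x - fourier_sum n f x)" for n
  have E: "E \<longlonglongrightarrow> 0" using conv by (simp only: E_def[abs_def])
  have B: "norm (fourier_coeff f k) \<le> B" for k unfolding B_def by (rule norm_fourier_coeff_le)
  have w1: "filterlim (\<lambda>m. window m - 1) at_top sequentially"
    unfolding filterlim_at_top
  proof
    fix n show "eventually (\<lambda>m. n \<le> window m - 1) sequentially"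
      using eventually_window_ge[of "n + 1"] by eventually_elim simp
  qed
  have m1: "filterlim (\<lambda>m::nat. m - 1) at_top sequentially"
    by (rule filterlim_minus_const_nat_at_top)
  have sq: "(\<lambda>m. B / sqrt (real m)) \<longlonglongrightarrow> 0"
    by (intro real_tendsto_divide_at_top[OF tendsto_const] filterlim_compose[OF sqrt_at_top filterlim_real_sequentially])
  have "(\<lambda>m. (E (m - 1) + E (window m - 1)) / 2 + B / sqrt (real m)) \<longlonglongrightarrow> (0 + 0) / 2 + 0"
    by (intro tendsto_intros filterlim_compose[OF E w1] filterlim_compose[OF E m1] sq) auto
  hence lim: "(\<lambda>m. (E (m - 1) + E (window m - 1)) / 2 + B / sqrt (real m)) \<longlonglongrightarrow> 0" by simp
  show ?thesis
  proof (rule Lim_null_comparison[OF _ lim])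
    show "eventually (\<lambda>m. norm (\<Sum>k=window m..<m. fourier_coeff f (s * int k) / of_nat (m - k))
       \<le> (E (m - 1) + E (window m - 1)) / 2 + B / sqrt (real m)) sequentially"
      using eventually_window_ge[of 1]
    proof eventually_elim
      case (elim m)
      have "m > 0" using elim window_le[of m] by linarith
      have h1: "norm (\<Sum>k=window m..<m. fourier_coeff f (s * int k) / of_nat (m - k))
         \<le> L_norm (\<lambda>x. fourier_sum (m - 1) f x - fourier_sum (window m - 1) f x) / 2 + B * real (m - window m) / real m"
        by (rule norm_hilbert_block_le[OF s elim window_le B])
      have h2: "L_norm (\<lambda>x. fourier_sum (m - 1) f x - fourier_sum (window m - 1) f x) \<le> E (m - 1) + E (window m - 1)"
        using L_norm_triangle[of "fourier_sum (m - 1) f" f "fourier_sum (window m - 1) f"] f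
          L_norm_minus_commute[of f "fourier_sum (m - 1) f"] by (simp add: E_def)
      have h3: "B * real (m - window m) / real m \<le> B * sqrt (real m) / real m"
        using m_minus_window_le_sqrt[of m] by (intro divide_right_mono mult_left_mono) (auto simp: B_def)
      have h4: "B * sqrt (real m) / real m = B / sqrt (real m)"
        using \<open>m > 0\<close> by (simp add: real_div_sqrt field_simps)
      show ?case
        by (rule order_trans[OF h1 add_mono[OF divide_right_mono[OF h2] order_trans[OF h3 eq_refl[OF h4]]]]) simp
    qed
  qed
qed

lemma sector_Re_ge:
  assumes "z \<in> sector \<theta>" "\<theta> \<in> {0..<pi/2}"
  shows "cos \<theta> * norm z \<le> Re z"
proof -
  have "\<bar>Arg z\<bar> \<le> \<theta>" using assms by (simp add: sector_def)
  hence "cos \<theta> \<le> cos \<bar>Arg z\<bar>" using assms by (subst cos_mono_le_eq) auto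
  hence "cos \<theta> * norm z \<le> cos (Arg z) * norm z" by (intro mult_right_mono) auto
  also have "\<dots> = Re z"
  proof (cases "z = 0")
    case False
    hence "z = of_real (norm z) * exp (\<i> * of_real (Arg z))" by (rule Arg_eq)
    thus ?thesis by (metis Re_complex_of_real Re_rcis cis_conv_exp mult.commute rcis_def)
  qed simp
  finally show ?thesis .
qed

text \<open>The Max in the class GBV is replaced by a sum over the same indices, since sums can be
  interchanged with the Hilbert weights.\<close>

lemma GBV_norm_le_sum:
  assumes var: "(\<Sum>n=k..2*k. norm (seq_diff c n)) \<le> M * Max ((\<lambda>n. norm (c n)) ` {k..<k + N})"
    and "M > 0" "N \<ge> 1" "k \<le> m" "m \<le> 2 * k"
  shows "norm (c m) \<le> (1 + M) * (\<Sum>j<N. norm (c (k + j)))"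
proof -
  let ?S = "\<Sum>j<N. norm (c (k + j))"
  have le: "norm (c (k + j)) \<le> ?S" if "j < N" for j
    using that by (intro member_le_sum[of j "{..<N}" "\<lambda>j. norm (c (k + j))"]) auto
  have "norm (c k - c m) \<le> (\<Sum>j=k..<m. norm (seq_diff c j))"
    by (rule norm_seq_diff_telescope) fact
  also have "\<dots> \<le> (\<Sum>n=k..2*k. norm (seq_diff c n))"
    using assms by (intro sum_mono2) auto
  also note var
  also have "Max ((\<lambda>n. norm (c n)) ` {k..<k + N}) \<le> ?S"
  proof (rule Max.boundedI)
    fix y assume "y \<in> (\<lambda>n. norm (c n)) ` {k..<k + N}"
    then obtain n where "n \<in> {k..<k + N}" "y = norm (c n)" by blast
    thus "y \<le> ?S" using le[of "n - k"] by auto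
  qed (use \<open>N \<ge> 1\<close> in auto)
  finally have "norm (c k - c m) \<le> M * ?S" using \<open>M > 0\<close> by simp
  moreover have "norm (c m) \<le> norm (c k) + norm (c k - c m)" by (metis norm_minus_commute norm_triangle_sub)
  moreover have "norm (c k) \<le> ?S" using le[of 0] \<open>N \<ge> 1\<close> by simp
  ultimately show ?thesis by (simp add: distrib_right)
qed

text \<open>In a sector the real parts control the moduli, so the Hilbert sums dominate, up to a constant,
  the sums of the nonnegative terms \<open>norm (c k) / (m - k)\<close>. By the variation condition \<open>norm (c m)\<close> is
  bounded by a few coefficients next to each index of the window; averaging this bound with the
  Hilbert weights, whose total is of size \<open>ln m\<close>, bounds \<open>norm (c m) * ln m\<close> by a
  constant times the Hilbert sum.\<close>

lemma GBV_coeff_log_tendsto_0: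
  assumes c: "c \<in> GBV"
    and lim: "(\<lambda>m. \<Sum>k=window m..<m. c k / of_nat (m - k)) \<longlonglongrightarrow> 0"
  shows "(\<lambda>m. norm (c m) * ln (real m)) \<longlonglongrightarrow> 0"
proof -
  obtain \<theta> N M where th: "\<theta> \<in> {0..<pi/2}" and sec: "\<And>n. n \<ge> 1 \<Longrightarrow> c n \<in> sector \<theta>"
    and N: "N \<ge> 1" and M: "M > 0"
    and var: "\<And>m. m \<ge> 1 \<Longrightarrow> (\<Sum>n=m..2*m. norm (seq_diff c n)) \<le> M * Max ((\<lambda>n. norm (c n)) ` {m..<m + N})"
    using c unfolding GBV_def by auto
  have cpos: "cos \<theta> > 0" using th by (intro cos_gt_zero_pi) auto
  define H where "H m = norm (\<Sum>k=window m..<m. c k / of_nat (m - k))" for m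
  have H: "H \<longlonglongrightarrow> 0" unfolding H_def using lim by (rule tendsto_norm_zero)
  define C where "C = 4 * (1 + M) * real N / cos \<theta>"
  have "eventually (\<lambda>m. norm (norm (c m) * ln (real m)) \<le> C * H m) sequentially"
  proof -
    have "eventually (\<lambda>m. real m \<le> 2 * real (window m)) sequentially"
      by (rule eventually_le_mult_window) simp
    moreover have "eventually (\<lambda>m. ln (real m) \<ge> 4 * real N) sequentially"
      using filterlim_compose[OF ln_at_top filterlim_real_sequentially] by (simp add: filterlim_at_top)
    ultimately show ?thesis using eventually_window_ge[of 1]
    proof eventually_elim
      case (elim m)
      define p where "p = window m"
      have p: "1 \<le> p" "m \<le> 2 * p" "p \<le> m" using elim window_le[of m] by (auto simp: p_def)
      define R where "R = (\<Sum>k=p..<m. norm (c k) / real (m - k))"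
      have R0: "R \<ge> 0" unfolding R_def by (intro sum_nonneg) auto
      have "cos \<theta> * R = (\<Sum>k=p..<m. cos \<theta> * norm (c k) / real (m - k))"
        by (simp add: R_def sum_distrib_left)
      also have "\<dots> \<le> (\<Sum>k=p..<m. Re (c k / of_nat (m - k)))"
      proof (rule sum_mono)
        fix k assume k: "k \<in> {p..<m}"
        have "cos \<theta> * norm (c k) \<le> Re (c k)" using k p by (intro sector_Re_ge sec th) auto
        moreover have "Re (c k / of_nat (m - k)) = Re (c k) / real (m - k)"
          by (metis Re_divide_of_real of_real_of_nat_eq)
        ultimately show "cos \<theta> * norm (c k) / real (m - k) \<le> Re (c k / of_nat (m - k))"
          by (simp add: divide_right_mono)
      qed
      also have "\<dots> = Re (\<Sum>k=p..<m. c k / of_nat (m - k))" by (rule Re_sum[symmetric])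
      also have "\<dots> \<le> H m" unfolding H_def p_def by (rule complex_Re_le_cmod)
      finally have R: "cos \<theta> * R \<le> H m" .
      \<comment> \<open>the range of \<open>k\<close> ends at \<open>m - N\<close>, so that every shifted index \<open>k + j\<close> stays below \<open>m\<close>; shifting towards \<open>m\<close> only increases the weight\<close>
      have pt: "norm (c m) / real (m - k) \<le> (1 + M) * (\<Sum>j<N. norm (c (k + j)) / real (m - (k + j)))"
        if k: "k \<in> {p..<m + 1 - N}" for k
      proof -
        have "norm (c m) \<le> (1 + M) * (\<Sum>j<N. norm (c (k + j)))"
          using var[of k] M N k p by (intro GBV_norm_le_sum) auto
        hence "norm (c m) / real (m - k) \<le> (1 + M) * (\<Sum>j<N. norm (c (k + j))) / real (m - k)"
          by (rule divide_right_mono) simp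
        also have "\<dots> = (1 + M) * (\<Sum>j<N. norm (c (k + j)) / real (m - k))"
          unfolding sum_divide_distrib[symmetric] by simp
        also have "\<dots> \<le> (1 + M) * (\<Sum>j<N. norm (c (k + j)) / real (m - (k + j)))"
          using k M by (intro mult_left_mono sum_mono divide_left_mono) auto
        finally show ?thesis .
      qed
      have shift: "(\<Sum>k=p..<m + 1 - N. norm (c (k + j)) / real (m - (k + j))) \<le> R" if "j < N" for j
      proof -
        have "(\<Sum>k=p..<m + 1 - N. norm (c (k + j)) / real (m - (k + j)))
            = (\<Sum>k=p + j..<m + 1 - N + j. norm (c k) / real (m - k))"
          by (rule sum.shift_bounds_nat_ivl[symmetric])
        also have "\<dots> \<le> R" unfolding R_def using that
          by (intro sum_mono2) auto
        finally show ?thesis .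
      qed
      have "norm (c m) * (\<Sum>k=p..<m + 1 - N. 1 / real (m - k)) = (\<Sum>k=p..<m + 1 - N. norm (c m) / real (m - k))"
        by (simp add: sum_distrib_left)
      also have "\<dots> \<le> (\<Sum>k=p..<m + 1 - N. (1 + M) * (\<Sum>j<N. norm (c (k + j)) / real (m - (k + j))))"
        by (intro sum_mono pt)
      also have "\<dots> = (1 + M) * (\<Sum>j<N. \<Sum>k=p..<m + 1 - N. norm (c (k + j)) / real (m - (k + j)))"
        unfolding sum_distrib_left[symmetric] by (subst sum.swap) (rule refl)
      also have "\<dots> \<le> (1 + M) * (\<Sum>j<N. R)"
        using M by (intro mult_left_mono sum_mono shift) auto
      also have "\<dots> = (1 + M) * real N * R" by simp
      finally have 1: "norm (c m) * (\<Sum>k=p..<m + 1 - N. 1 / real (m - k)) \<le> (1 + M) * real N * R" .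
      \<comment> \<open>the indices lost next to \<open>m\<close> carry weight at most \<open>N\<close>, which is at most a quarter of \<open>ln m\<close>\<close>
      have "harm_window m \<le> (\<Sum>k=p..<m + 1 - N. 1 / real (m - k)) + (\<Sum>k=m + 1 - N..<m. 1 / real (m - k))"
      proof -
        have "harm_window m \<le> (\<Sum>k\<in>{p..<m + 1 - N} \<union> {m + 1 - N..<m}. 1 / real (m - k))"
          unfolding harm_window_def p_def by (intro sum_mono2) auto
        also have "\<dots> = (\<Sum>k=p..<m + 1 - N. 1 / real (m - k)) + (\<Sum>k=m + 1 - N..<m. 1 / real (m - k))"
          by (rule sum.union_disjoint) auto
        finally show ?thesis .
      qed
      also have "(\<Sum>k=m + 1 - N..<m. 1 / real (m - k)) \<le> (\<Sum>k=m + 1 - N..<m. 1)"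
        by (intro sum_mono) auto
      also have "\<dots> \<le> real N" by simp
      finally have "(\<Sum>k=p..<m + 1 - N. 1 / real (m - k)) \<ge> ln (real m) / 4"
        using harm_window_ge[of m] elim p by linarith
      hence "norm (c m) * (ln (real m) / 4) \<le> (1 + M) * real N * R"
        using 1 by (meson mult_left_mono norm_ge_zero order_trans)
      also have "\<dots> \<le> (1 + M) * real N * (H m / cos \<theta>)"
        using R cpos M by (intro mult_left_mono) (auto simp: field_simps)
      also have "\<dots> = C * H m / 4" by (simp add: C_def del: distrib_left_numeral)
      finally have "norm (c m) * ln (real m) \<le> C * H m" by simp
      moreover have "ln (real m) \<ge> 0" using p by simp
      ultimately show ?case by simp
    qed
  qed
  moreover have "(\<lambda>m. C * H m) \<longlonglongrightarrow> 0" using tendsto_mult_right_zero[OF H] .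
  ultimately show ?thesis by (rule Lim_null_comparison)
qed

text \<open>Here no sign is available, but within a window the sequence differs from \<open>d m\<close> by at most
  \<open>e / ln m\<close> up to a constant. Hence the Hilbert sum is \<open>d m\<close> times the total weight, up to an error of
  at most a constant times \<open>e\<close>, whereas that weight is at least \<open>ln m / 2\<close>.\<close>

lemma slow_variation_coeff_log_tendsto_0:
  fixes d :: "nat \<Rightarrow> complex"
  assumes osc: "\<And>e. e > 0 \<Longrightarrow> \<exists>lam>1. eventually (\<lambda>n.
      (\<Sum>k=n..nat \<lfloor>lam * real n\<rfloor>. norm (seq_diff d k) * ln (real k)) < e) sequentially"
    and lim: "(\<lambda>m. \<Sum>k=window m..<m. d k / of_nat (m - k)) \<longlonglongrightarrow> 0"
  shows "(\<lambda>m. norm (d m) * ln (real m)) \<longlonglongrightarrow> 0"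
proof (rule tendstoI)
  fix e :: real assume e: "e > 0"
  define H where "H m = norm (\<Sum>k=window m..<m. d k / of_nat (m - k))" for m
  have H: "H \<longlonglongrightarrow> 0" unfolding H_def using lim by (rule tendsto_norm_zero)
  obtain lam where lam: "lam > 1" and ev: "eventually (\<lambda>n.
      (\<Sum>k=n..nat \<lfloor>lam * real n\<rfloor>. norm (seq_diff d k) * ln (real k)) < e / 4) sequentially"
    using osc[of "e / 4"] e by auto
  have "filterlim window at_top sequentially"
    unfolding filterlim_at_top using eventually_window_ge by blast
  note ev' = eventually_compose_filterlim[OF ev this]
  have "eventually (\<lambda>m. H m < e / 4) sequentially" using H e by (intro order_tendstoD) auto
  with ev' eventually_le_mult_window[OF lam] eventually_ln_window_ge eventually_window_ge[of 2]
  show "eventually (\<lambda>m. dist (norm (d m) * ln (real m)) 0 < e) sequentially"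
  proof eventually_elim
    case (elim m)
    define p where "p = window m"
    have p: "2 \<le> p" "p \<le> m" using elim window_le[of m] by (auto simp: p_def)
    have lp: "ln (real p) > 0" using p by simp
    have lm: "ln (real m) > 0" using p by simp
    have near: "norm (d m - d k) \<le> e / 4 / ln (real p)" if k: "k \<in> {p..<m}" for k
    proof -
      have "norm (d m - d k) * ln (real p) \<le> (\<Sum>j=k..<m. norm (seq_diff d j)) * ln (real p)"
        using norm_seq_diff_telescope[of k m d] k lp
        by (intro mult_right_mono) (auto simp: norm_minus_commute)
      also have "\<dots> \<le> (\<Sum>j=k..<m. norm (seq_diff d j) * ln (real j))"
        unfolding sum_distrib_right using k p by (intro sum_mono mult_left_mono) auto
      also have "\<dots> \<le> (\<Sum>j=p..nat \<lfloor>lam * real p\<rfloor>. norm (seq_diff d j) * ln (real j))"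
      proof (rule sum_mono2)
        have "int m \<le> \<lfloor>lam * real p\<rfloor>" using elim(2) by (simp add: p_def le_floor_iff)
        hence "m \<le> nat \<lfloor>lam * real p\<rfloor>" by linarith
        thus "{k..<m} \<subseteq> {p..nat \<lfloor>lam * real p\<rfloor>}" using k by auto
        show "0 \<le> norm (seq_diff d j) * ln (real j)" if "j \<in> {p..nat \<lfloor>lam * real p\<rfloor>} - {k..<m}" for j
          using that p by (intro mult_nonneg_nonneg) auto
      qed simp
      also have "\<dots> < e / 4" using elim(1) by (simp add: p_def)
      finally show ?thesis using lp by (simp add: field_simps)
    qed
    let ?h = "harm_window m"
    have h: "?h \<ge> ln (real m) / 2" using p by (intro harm_window_ge) auto
    have "norm (d m) * ?h = norm (\<Sum>k=p..<m. d m / of_nat (m - k))"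
    proof -
      have "(\<Sum>k=p..<m. d m / of_nat (m - k)) = d m * of_real ?h"
        by (simp add: harm_window_def p_def sum_distrib_left)
      moreover have "?h \<ge> 0" using h lm by linarith
      ultimately show ?thesis by (simp add: norm_mult)
    qed
    also have "(\<Sum>k=p..<m. d m / of_nat (m - k))
        = (\<Sum>k=p..<m. d k / of_nat (m - k)) + (\<Sum>k=p..<m. (d m - d k) / of_nat (m - k))"
      by (simp add: sum.distrib[symmetric] diff_divide_distrib)
    also have "norm \<dots> \<le> H m + norm (\<Sum>k=p..<m. (d m - d k) / of_nat (m - k))"
      unfolding H_def p_def by (rule norm_triangle_ineq)
    also have "norm (\<Sum>k=p..<m. (d m - d k) / of_nat (m - k)) \<le> (\<Sum>k=p..<m. e / 4 / ln (real p) * (1 / real (m - k)))"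
    proof (rule sum_norm_le)
      fix k assume k: "k \<in> {p..<m}"
      have "norm (d m - d k) / real (m - k) \<le> e / 4 / ln (real p) / real (m - k)"
        by (intro divide_right_mono near k) simp
      thus "norm ((d m - d k) / of_nat (m - k)) \<le> e / 4 / ln (real p) * (1 / real (m - k))"
        by (simp add: norm_divide del: of_nat_diff)
    qed
    also have "\<dots> = e / 4 / ln (real p) * ?h" by (simp add: harm_window_def p_def sum_distrib_left)
    finally have main: "norm (d m) * ?h \<le> H m + e / 4 / ln (real p) * ?h" by simp
    have "e / 4 / ln (real p) \<le> e / 4 / (ln (real m) / 2)"
      using elim(3) e lm by (intro divide_left_mono) (auto simp: p_def)
    hence "(norm (d m) - e / 2 / ln (real m)) * ?h \<le> (norm (d m) - e / 4 / ln (real p)) * ?h"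
      using h lm by (intro mult_right_mono) auto
    also have "\<dots> \<le> H m" using main by (simp add: left_diff_distrib)
    finally have *: "(norm (d m) - e / 2 / ln (real m)) * ?h \<le> H m" .
    have "norm (d m) * ln (real m) < e"
    proof (cases "norm (d m) \<ge> e / 2 / ln (real m)")
      case True
      have "(norm (d m) - e / 2 / ln (real m)) * (ln (real m) / 2) \<le> H m"
        using True h * by (meson diff_ge_0_iff_ge mult_left_mono order_trans)
      hence "norm (d m) * ln (real m) / 2 - e / 4 \<le> H m"
        using lm by (simp add: left_diff_distrib)
      thus ?thesis using elim by linarith
    next
      case False
      hence "norm (d m) * ln (real m) < e / 2" using lm by (simp add: field_simps)
      thus ?thesis using e by linarith
    qed
    thus ?case using lm by simp
  qed
qed

section \<open>Equivalence of mean convergence and logarithmic decay\<close>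

text \<open>A single \<open>lam\<close> for each precision suffices for both directions; it is chosen below 2 so that a block fits
  into the range \<open>{n..2 * n}\<close> of the variation condition.\<close>

lemma small_oscillation_block:
  fixes d :: "nat \<Rightarrow> complex"
  assumes lim: "((\<lambda>lam::real. limsup (\<lambda>n. ereal (\<Sum>k=n..nat \<lfloor>lam * real n\<rfloor>. norm (d k) * ln (real k)))) \<longlongrightarrow> 0) (at_right 1)"
    and e: "e > 0"
  shows "\<exists>lam. 1 < lam \<and> lam < 2 \<and> eventually (\<lambda>n.
      (\<Sum>k=n..nat \<lfloor>lam * real n\<rfloor>. norm (d k) * ln (real k)) < e) sequentially"
proof -
  define g where "g lam n = (\<Sum>k=n..nat \<lfloor>lam * real n\<rfloor>. norm (d k) * ln (real k))" for lam :: real and n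
  have "eventually (\<lambda>lam. limsup (\<lambda>n. ereal (g lam n)) < ereal e) (at_right 1)"
    unfolding g_def using e by (intro order_tendstoD(2)[OF lim]) simp
  moreover have "eventually (\<lambda>lam::real. lam \<in> {1<..<2}) (at_right 1)"
    by (rule eventually_at_right_real) simp
  ultimately have "eventually (\<lambda>lam. limsup (\<lambda>n. ereal (g lam n)) < ereal e \<and> lam \<in> {1<..<2}) (at_right 1)"
    by (rule eventually_conj)
  hence "\<exists>lam. limsup (\<lambda>n. ereal (g lam n)) < ereal e \<and> lam \<in> {1<..<2}"
    by (rule eventually_happens'[OF trivial_limit_at_right_real[unfolded atomize_not]])
  then obtain lam where lam: "limsup (\<lambda>n. ereal (g lam n)) < ereal e" "lam \<in> {1<..<2}" by blast
  have "eventually (\<lambda>n. ereal (g lam n) < ereal e) sequentially" by (rule Limsup_lessD[OF lam(1)])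
  thus ?thesis using lam(2) by (auto simp: g_def)
qed

lemma tendsto_abs_at_top_iff:
  fixes g :: "int \<Rightarrow> complex"
  shows "(g \<longlongrightarrow> 0) (filtercomap (\<lambda>n. \<bar>n\<bar>) at_top) \<longleftrightarrow>
    ((\<lambda>m. g (int m)) \<longlonglongrightarrow> 0) \<and> ((\<lambda>m. g (- int m)) \<longlonglongrightarrow> 0)"
proof
  assume L: "(g \<longlongrightarrow> 0) (filtercomap (\<lambda>n. \<bar>n\<bar>) at_top)"
  have f1: "filterlim int (filtercomap (\<lambda>n. \<bar>n\<bar>) at_top) sequentially"
    and f2: "filterlim (\<lambda>m. - int m) (filtercomap (\<lambda>n. \<bar>n\<bar>) at_top) sequentially"
    by (simp_all add: filterlim_filtercomap_iff o_def filterlim_int_sequentially)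
  show "((\<lambda>m. g (int m)) \<longlonglongrightarrow> 0) \<and> ((\<lambda>m. g (- int m)) \<longlonglongrightarrow> 0)"
    using filterlim_compose[OF L f1] filterlim_compose[OF L f2] by simp
next
  assume R: "((\<lambda>m. g (int m)) \<longlonglongrightarrow> 0) \<and> ((\<lambda>m. g (- int m)) \<longlonglongrightarrow> 0)"
  show "(g \<longlongrightarrow> 0) (filtercomap (\<lambda>n. \<bar>n\<bar>) at_top)"
  proof (rule tendstoI)
    fix e :: real assume "e > 0"
    hence "eventually (\<lambda>m. dist (g (int m)) 0 < e \<and> dist (g (- int m)) 0 < e) sequentially"
      using R by (intro eventually_conj) (auto dest: tendstoD)
    then obtain m0 where m0: "\<And>m. m \<ge> m0 \<Longrightarrow> dist (g (int m)) 0 < e \<and> dist (g (- int m)) 0 < e"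
      by (auto simp: eventually_sequentially)
    have "dist (g k) 0 < e" if "\<bar>k\<bar> \<ge> int m0" for k
      using m0[of "nat \<bar>k\<bar>"] that by (cases "k \<ge> 0") auto
    thus "eventually (\<lambda>k. dist (g k) 0 < e) (filtercomap (\<lambda>n. \<bar>n\<bar>) at_top)"
      unfolding eventually_filtercomap_at_top_linorder by blast
  qed
qed

text \<open>All terms of a block with indices between \<open>n\<close> and \<open>lam * n < 2 * n\<close> are \<open>o(1 / ln n)\<close>. The
  variation of the coefficients at positive frequencies is controlled by the class GBV, and that at
  negative frequencies by comparison with the former; the logarithm lost in the norms of the
  Dirichlet sums is compensated in both cases.\<close>

lemma fourier_sum_slowly_oscillating:
  fixes f :: "real \<Rightarrow> complex"
  defines "a \<equiv> \<lambda>k. fourier_coeff f (int k)" and "b \<equiv> \<lambda>k. fourier_coeff f (- int k)"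
  assumes var: "\<And>m. m \<ge> 1 \<Longrightarrow> (\<Sum>n=m..2*m. norm (seq_diff a n)) \<le> M * Max ((\<lambda>n. norm (a n)) ` {m..<m + N})"
    and M: "M > 0" and N: "N \<ge> 1"
    and osc: "\<And>e. e > 0 \<Longrightarrow> \<exists>lam. 1 < lam \<and> lam < 2 \<and> eventually (\<lambda>n.
      (\<Sum>k=n..nat \<lfloor>lam * real n\<rfloor>. norm (seq_diff a k - seq_diff b k) * ln (real k)) < e) sequentially"
    and a: "(\<lambda>m. norm (a m) * ln (real m)) \<longlonglongrightarrow> 0" and b: "(\<lambda>m. norm (b m) * ln (real m)) \<longlonglongrightarrow> 0"
    and e: "e > 0"
  shows "\<exists>lam>1. eventually (\<lambda>n. \<forall>j\<in>{n..<nat \<lfloor>lam * real n\<rfloor>}.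
       L_norm (\<lambda>x. fourier_sum j f x - fourier_sum n f x) \<le> e) sequentially"
proof -
  \<comment> \<open>makes the contributions below add up to exactly \<open>e\<close>\<close>
  define h where "h = e / (8 * pi) / (2 * (1 + M))"
  have h: "h > 0" using e M by (simp add: h_def)
  have h_eq: "(h + h + M * h + (M * h + e / (8 * pi))) * (4 * pi) = e"
  proof -
    have "h * (2 * (1 + M)) = e / (8 * pi)" using M by (simp add: h_def)
    hence "h + h + M * h + (M * h + e / (8 * pi)) = 2 * (e / (8 * pi))" by (simp add: algebra_simps)
    also have "\<dots> * (4 * pi) = e" by simp
    finally show ?thesis .
  qed
  obtain lam where lam: "1 < lam" "lam < 2" and ev: "eventually (\<lambda>n.
      (\<Sum>k=n..nat \<lfloor>lam * real n\<rfloor>. norm (seq_diff a k - seq_diff b k) * ln (real k)) < e / (8 * pi)) sequentially"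
    using osc[of "e / (8 * pi)"] e by auto
  have "eventually (\<lambda>m. norm (a m) * ln (real m) < h \<and> norm (b m) * ln (real m) < h) sequentially"
    using a b h by (intro eventually_conj order_tendstoD(2)) auto
  then obtain n0 where n0: "\<And>m. m \<ge> n0 \<Longrightarrow> norm (a m) * ln (real m) < h \<and> norm (b m) * ln (real m) < h"
    by (auto simp: eventually_sequentially)
  show ?thesis
  proof (intro exI conjI)
    show "eventually (\<lambda>n. \<forall>j\<in>{n..<nat \<lfloor>lam * real n\<rfloor>}.
       L_norm (\<lambda>x. fourier_sum j f x - fourier_sum n f x) \<le> e) sequentially"
      using ev eventually_ge_at_top[of "max 2 n0"]
    proof eventually_elim
      case (elim n)
      have n: "n \<ge> 2" "n \<ge> n0" using elim(2) by auto
      define l where "l = ln (real n)"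
      have l: "l > 0" using n by (simp add: l_def)
      have small: "norm (a m) \<le> h / l" "norm (b m) \<le> h / l" if "m \<ge> n" for m
      proof -
        have "l \<le> ln (real m)" using that n by (simp add: l_def)
        hence "norm (a m) * l \<le> norm (a m) * ln (real m)" "norm (b m) * l \<le> norm (b m) * ln (real m)"
          by (auto intro: mult_left_mono)
        moreover have "norm (a m) * ln (real m) < h" "norm (b m) * ln (real m) < h"
          using n0[of m] that n by auto
        ultimately show "norm (a m) \<le> h / l" "norm (b m) \<le> h / l"
          using l by (simp_all add: pos_le_divide_eq)
      qed
      show ?case
      proof
        fix j assume j: "j \<in> {n..<nat \<lfloor>lam * real n\<rfloor>}"
        have "lam * real n < 2 * real n" using lam n by simp
        hence jn: "n \<le> j" "j < 2 * n" using j by (auto, linarith)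
        let ?I = "{Suc n..<Suc j}"
        have "(\<Sum>k\<in>?I. norm (seq_diff a k)) \<le> (\<Sum>k=n..2*n. norm (seq_diff a k))"
          using jn by (intro sum_mono2) auto
        also have "\<dots> \<le> M * (h / l)"
          using n by (intro GBV_block_le[OF var M N] small) auto
        finally have A: "(\<Sum>k\<in>?I. norm (seq_diff a k)) \<le> M * h / l" by simp
        have "(\<Sum>k\<in>?I. norm (seq_diff a k - seq_diff b k)) * l
            \<le> (\<Sum>k\<in>?I. norm (seq_diff a k - seq_diff b k) * ln (real k))"
          unfolding sum_distrib_right l_def using n by (intro sum_mono mult_left_mono) auto
        also have "\<dots> \<le> (\<Sum>k=n..nat \<lfloor>lam * real n\<rfloor>. norm (seq_diff a k - seq_diff b k) * ln (real k))"
          using j n by (intro sum_mono2) (auto intro!: mult_nonneg_nonneg)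
        also have "\<dots> < e / (8 * pi)" by (rule elim(1))
        finally have D: "(\<Sum>k\<in>?I. norm (seq_diff a k - seq_diff b k)) \<le> e / (8 * pi) / l"
          unfolding pos_le_divide_eq[OF l] by (rule less_imp_le)
        have "(\<Sum>k\<in>?I. norm (seq_diff b k)) \<le> (\<Sum>k\<in>?I. norm (seq_diff a k) + norm (seq_diff a k - seq_diff b k))"
          by (intro sum_mono) (metis norm_minus_commute norm_triangle_sub)
        hence B: "(\<Sum>k\<in>?I. norm (seq_diff b k)) \<le> M * h / l + e / (8 * pi) / l"
          using A D by (simp add: sum.distrib)
        have ln_le: "ln (real (j - n) + 1) \<le> l" unfolding l_def using jn n by (subst ln_le_cancel_iff) auto
        have "L_norm (\<lambda>x. fourier_sum j f x - fourier_sum n f x)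
          \<le> (norm (a (Suc j)) + norm (b (Suc j)) + (\<Sum>k\<in>?I. norm (seq_diff a k)) + (\<Sum>k\<in>?I. norm (seq_diff b k)))
            * (4 * pi * ln (real (j - n) + 1))"
          unfolding a_def b_def by (rule L_norm_fourier_sum_diff_le[OF jn(1)])
        also have "\<dots> \<le> (h / l + h / l + M * h / l + (M * h / l + e / (8 * pi) / l)) * (4 * pi * l)"
        proof (rule mult_mono)
          show "norm (a (Suc j)) + norm (b (Suc j)) + (\<Sum>k\<in>?I. norm (seq_diff a k)) + (\<Sum>k\<in>?I. norm (seq_diff b k))
             \<le> h / l + h / l + M * h / l + (M * h / l + e / (8 * pi) / l)"
            using A B small[of "Suc j"] jn by (intro add_mono) auto
          show "4 * pi * ln (real (j - n) + 1) \<le> 4 * pi * l" using ln_le by simp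
          show "0 \<le> h / l + h / l + M * h / l + (M * h / l + e / (8 * pi) / l)"
            using h l M e by (intro add_nonneg_nonneg) auto
        qed simp
        also have "h / l + h / l + M * h / l + (M * h / l + e / (8 * pi) / l)
            = (h + h + M * h + (M * h + e / (8 * pi))) / l"
          unfolding add_divide_distrib ..
        also have "\<dots> * (4 * pi * l) = (h + h + M * h + (M * h + e / (8 * pi))) * (4 * pi)"
          using less_imp_neq[OF l] by simp
        also have "\<dots> = e" by (rule h_eq)
        finally show "L_norm (\<lambda>x. fourier_sum j f x - fourier_sum n f x) \<le> e" .
      qed
    qed
  qed (rule lam(1))
qed

theorem theorem1:
  fixes f :: "real \<Rightarrow> complex"
  assumes "f \<in> L_2pi"
    and "((\<lambda>lam::real. limsup (\<lambda>n. ereal (\<Sum>k=n..nat \<lfloor>lam * real n\<rfloor>.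
            norm (seq_diff (\<lambda>j. fourier_coeff f (int j)) k
                  - seq_diff (\<lambda>j. fourier_coeff f (- int j)) k) * ln (real k))))
          \<longlongrightarrow> 0) (at_right 1)"
    and "(\<lambda>n. fourier_coeff f (int n)) \<in> GBV"
  shows "((\<lambda>n. L_norm (\<lambda>x. f x - fourier_sum n f x)) \<longlonglongrightarrow> 0) \<longleftrightarrow>
         ((\<lambda>n::int. fourier_coeff f n * of_real (ln (of_int \<bar>n\<bar>))) \<longlongrightarrow> 0)
           (filtercomap (\<lambda>n. \<bar>n\<bar>) at_top)"
proof -
  have f: "integrable period_measure f"
    using assms(1) by (simp add: L_2pi_def set_integrable_period_iff)
  define a where "a = (\<lambda>k. fourier_coeff f (int k))"
  define b where "b = (\<lambda>k. fourier_coeff f (- int k))"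
  note osc = small_oscillation_block[OF assms(2), folded a_def b_def]
  have GBV: "a \<in> GBV" using assms(3) by (simp add: a_def)
  obtain N M where NM: "N \<ge> 1" "M > 0"
    "\<And>m. m \<ge> 1 \<Longrightarrow> (\<Sum>n=m..2*m. norm (seq_diff a n)) \<le> M * Max ((\<lambda>n. norm (a n)) ` {m..<m + N})"
    using GBV unfolding GBV_def by blast
  have coeffs: "((\<lambda>n::int. fourier_coeff f n * of_real (ln (of_int \<bar>n\<bar>))) \<longlongrightarrow> 0) (filtercomap (\<lambda>n. \<bar>n\<bar>) at_top)
     \<longleftrightarrow> ((\<lambda>m. norm (a m) * ln (real m)) \<longlonglongrightarrow> 0) \<and> ((\<lambda>m. norm (b m) * ln (real m)) \<longlonglongrightarrow> 0)"
  proof -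
    have "((\<lambda>m. c m * complex_of_real (ln (real m))) \<longlonglongrightarrow> 0) \<longleftrightarrow> ((\<lambda>m. norm (c m) * ln (real m)) \<longlonglongrightarrow> 0)" for c
    proof -
      have "ln (real m) \<ge> 0" for m by (cases "m = 0") auto
      hence "(\<lambda>m. norm (c m) * ln (real m)) = (\<lambda>m. norm (c m * complex_of_real (ln (real m))))"
        by (simp add: norm_mult fun_eq_iff)
      thus ?thesis by (simp only: tendsto_norm_zero_iff)
    qed
    thus ?thesis unfolding tendsto_abs_at_top_iff by (simp add: a_def b_def)
  qed
  show ?thesis unfolding coeffs
  proof
    assume conv: "(\<lambda>n. L_norm (\<lambda>x. f x - fourier_sum n f x)) \<longlonglongrightarrow> 0"
    have Ha: "(\<lambda>m. \<Sum>k=window m..<m. a k / of_nat (m - k)) \<longlonglongrightarrow> 0"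
      using hilbert_window_tendsto_0[OF f conv, of 1] by (simp add: a_def)
    have Hb: "(\<lambda>m. \<Sum>k=window m..<m. b k / of_nat (m - k)) \<longlonglongrightarrow> 0"
      using hilbert_window_tendsto_0[OF f conv, of "-1"] by (simp add: b_def)
    have A: "(\<lambda>m. norm (a m) * ln (real m)) \<longlonglongrightarrow> 0"
      by (rule GBV_coeff_log_tendsto_0[OF GBV Ha])
    define d where "d k = a k - b k" for k
    have sd: "seq_diff a k - seq_diff b k = seq_diff d k" for k
      by (simp add: d_def seq_diff_def)
    have Hd: "(\<lambda>m. \<Sum>k=window m..<m. d k / of_nat (m - k)) \<longlonglongrightarrow> 0"
      using tendsto_diff[OF Ha Hb] by (simp add: d_def diff_divide_distrib sum_subtractf)
    have D: "(\<lambda>m. norm (d m) * ln (real m)) \<longlonglongrightarrow> 0"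
    proof (rule slow_variation_coeff_log_tendsto_0[OF _ Hd])
      fix e :: real assume "e > 0"
      from osc[OF this] show "\<exists>lam>1. eventually (\<lambda>n.
        (\<Sum>k=n..nat \<lfloor>lam * real n\<rfloor>. norm (seq_diff d k) * ln (real k)) < e) sequentially"
        unfolding sd by blast
    qed
    have "(\<lambda>m. norm (b m) * ln (real m)) \<longlonglongrightarrow> 0"
    proof (rule Lim_null_comparison)
      show "eventually (\<lambda>m. norm (norm (b m) * ln (real m)) \<le> norm (a m) * ln (real m) + norm (d m) * ln (real m)) sequentially"
        using eventually_ge_at_top[of 1]
      proof eventually_elim
        case (elim m)
        have "norm (b m) \<le> norm (a m) + norm (d m)"
          using norm_triangle_ineq4[of "a m" "d m"] by (simp add: d_def)
        moreover have "ln (real m) \<ge> 0" using elim by simp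
        ultimately show ?case by (simp add: distrib_right[symmetric] mult_right_mono)
      qed
      show "(\<lambda>m. norm (a m) * ln (real m) + norm (d m) * ln (real m)) \<longlonglongrightarrow> 0"
        using tendsto_add[OF A D] by simp
    qed
    with A show "((\<lambda>m. norm (a m) * ln (real m)) \<longlonglongrightarrow> 0) \<and> ((\<lambda>m. norm (b m) * ln (real m)) \<longlonglongrightarrow> 0)" ..
  next
    assume "((\<lambda>m. norm (a m) * ln (real m)) \<longlonglongrightarrow> 0) \<and> ((\<lambda>m. norm (b m) * ln (real m)) \<longlonglongrightarrow> 0)"
    hence A: "(\<lambda>m. norm (a m) * ln (real m)) \<longlonglongrightarrow> 0" and B: "(\<lambda>m. norm (b m) * ln (real m)) \<longlonglongrightarrow> 0" by auto
    show "(\<lambda>n. L_norm (\<lambda>x. f x - fourier_sum n f x)) \<longlonglongrightarrow> 0"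
    proof (rule fourier_sum_converges_if_slowly_oscillating[OF f])
      fix e :: real assume "e > 0"
      thus "\<exists>lam>1. eventually (\<lambda>n. \<forall>j\<in>{n..<nat \<lfloor>lam * real n\<rfloor>}.
          L_norm (\<lambda>x. fourier_sum j f x - fourier_sum n f x) \<le> e) sequentially"
        by (intro fourier_sum_slowly_oscillating[OF _ NM(2,1) _ A[unfolded a_def] B[unfolded b_def]]
              NM(3)[unfolded a_def] osc[unfolded a_def b_def])
    qed
  qed
qed

end
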